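(* Assume $\mathsf{W[1]}\neq\mathsf{FPT}$. Then for all constants $r, C \ge 1$ and every computable function $f$, there is no algorithm running in time $f(k)\cdot n^{C}$ that, given as input a 2CSP instance with $k$ variables and alphabet size $n$, distinguishes between the following two cases: (Completeness) there is an assignment satisfying all the constraints; (Soundness) no $r$-list assignment satisfies all the constraints.
   Context: A 2CSP instance $\Pi=(X,\Sigma,\Phi)$ consists of a finite set of variables $X=\{x_1,\dots,x_k\}$, a domain $\Sigma_{x}$ for each variable $x$ (the alphabet size $|\Sigma|$ is the maximum domain size), and a set of constraints $\Phi$, each constraint being a pair of variables $(w_1,w_2)\in X^2$ together with a relation $R\subseteq \Sigma_{w_1}\times\Sigma_{w_2}$. An assignment maps each variable to a value in its domain and satisfies a constraint if the pair of values lies in its relation. An $r$-list assignment (multi-assignment of size at most $r$) maps each variable $x$ to a subset $L(x)\subseteq\Sigma_x$ with $|L(x)|\le r$; it satisfies a constraint $((w_1,w_2),R)$ if there exist $u\in L(w_1)$, $v\in L(w_2)$ with $(u,v)\in R$. The hypothesis $\mathsf{W[1]}\neq\mathsf{FPT}$ is equivalent to: for every computable $f$, no algorithm decides whether a given 2CSP instance $(X,\Sigma,\Phi)$ is satisfiable in time $f(|X|)\cdot|\Sigma|^{O(1)}$ (equivalently, multicolored $k$-Clique is not solvable in time $f(k)n^{O(1)}$). *)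

theory Defs
  imports Complex_Main
begin

section \<open>2CSP instances and (list) assignments\<close>

text \<open>A constraint \<open>((w1, w2), R)\<close> is an ordered pair of variables (possibly equal) with a relation.\<close>

record ('v, 'a) csp =
  vars :: "'v set"
  vdom :: "'v \<Rightarrow> 'a set"
  constrs :: "(('v \<times> 'v) \<times> ('a \<times> 'a) set) set"

definition is_csp :: "('v, 'a) csp \<Rightarrow> bool" where
  "is_csp \<Pi> \<longleftrightarrow>
     finite (vars \<Pi>) \<and> (\<forall>x \<in> vars \<Pi>. finite (vdom \<Pi> x)) \<and> finite (constrs \<Pi>) \<and>
     (\<forall>((w1, w2), R) \<in> constrs \<Pi>. w1 \<in> vars \<Pi> \<and> w2 \<in> vars \<Pi> \<and> R \<subseteq> vdom \<Pi> w1 \<times> vdom \<Pi> w2)"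

definition num_vars :: "('v, 'a) csp \<Rightarrow> nat" where
  "num_vars \<Pi> = card (vars \<Pi>)"

definition alphabet_size :: "('v, 'a) csp \<Rightarrow> nat" where
  "alphabet_size \<Pi> = Max ((\<lambda>x. card (vdom \<Pi> x)) ` vars \<Pi>)"

definition is_assignment :: "('v, 'a) csp \<Rightarrow> ('v \<Rightarrow> 'a) \<Rightarrow> bool" where
  "is_assignment \<Pi> \<sigma> \<longleftrightarrow> (\<forall>x \<in> vars \<Pi>. \<sigma> x \<in> vdom \<Pi> x)"

definition satisfiable :: "('v, 'a) csp \<Rightarrow> bool" where
  "satisfiable \<Pi> \<longleftrightarrow>
     (\<exists>\<sigma>. is_assignment \<Pi> \<sigma> \<and> (\<forall>((w1, w2), R) \<in> constrs \<Pi>. (\<sigma> w1, \<sigma> w2) \<in> R))"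

definition is_list_assignment :: "nat \<Rightarrow> ('v, 'a) csp \<Rightarrow> ('v \<Rightarrow> 'a set) \<Rightarrow> bool" where
  "is_list_assignment r \<Pi> L \<longleftrightarrow>
     (\<forall>x \<in> vars \<Pi>. L x \<subseteq> vdom \<Pi> x \<and> finite (L x) \<and> card (L x) \<le> r)"

definition list_satisfiable :: "nat \<Rightarrow> ('v, 'a) csp \<Rightarrow> bool" where
  "list_satisfiable r \<Pi> \<longleftrightarrow>
     (\<exists>L. is_list_assignment r \<Pi> L \<and>
        (\<forall>((w1, w2), R) \<in> constrs \<Pi>. \<exists>u \<in> L w1. \<exists>v \<in> L w2. (u, v) \<in> R))"


section \<open>The machine model\<close>

text \<open>
  Algorithms are programs of Jones's WHILE language (N. D. Jones, Computability and Complexity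
  from a Programming Perspective, 1997): finitely many registers hold binary trees, and the
  elementary operations are forming a pair, taking a component, and testing for the empty tree.
  With the unit-cost measure below, running times agree with those of multitape Turing machines
  up to a polynomial.
\<close>

datatype tree = Leaf | Node tree tree

datatype exp = Var nat | Empty | Join exp exp | Hd exp | Tl exp

datatype com = Skip | Assign nat exp | Seq com com | If exp com com | While exp com

type_synonym store = "nat \<Rightarrow> tree"

fun hd_tree :: "tree \<Rightarrow> tree" where
  "hd_tree Leaf = Leaf"
| "hd_tree (Node a b) = a"

fun tl_tree :: "tree \<Rightarrow> tree" where
  "tl_tree Leaf = Leaf"
| "tl_tree (Node a b) = b"

fun val :: "exp \<Rightarrow> store \<Rightarrow> tree" where
  "val (Var x) s = s x"
| "val Empty s = Leaf"
| "val (Join e1 e2) s = Node (val e1 s) (val e2 s)"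
| "val (Hd e) s = hd_tree (val e s)"
| "val (Tl e) s = tl_tree (val e s)"

fun cost :: "exp \<Rightarrow> nat" where
  "cost (Var x) = 1"
| "cost Empty = 1"
| "cost (Join e1 e2) = 1 + cost e1 + cost e2"
| "cost (Hd e) = 1 + cost e"
| "cost (Tl e) = 1 + cost e"

text \<open>\<open>exec c s t s'\<close>: started in store \<open>s\<close>, program \<open>c\<close> halts in store \<open>s'\<close> after \<open>t\<close> steps.
  The empty tree is the truth value false; every other tree is true.\<close>

inductive exec :: "com \<Rightarrow> store \<Rightarrow> nat \<Rightarrow> store \<Rightarrow> bool" where
  Skip: "exec Skip s 1 s"
| Assign: "exec (Assign x e) s (1 + cost e) (s(x := val e s))"
| Seq: "exec c1 s t1 s1 \<Longrightarrow> exec c2 s1 t2 s2 \<Longrightarrow> exec (Seq c1 c2) s (t1 + t2) s2"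
| IfTrue: "val e s \<noteq> Leaf \<Longrightarrow> exec c1 s t s' \<Longrightarrow> exec (If e c1 c2) s (1 + cost e + t) s'"
| IfFalse: "val e s = Leaf \<Longrightarrow> exec c2 s t s' \<Longrightarrow> exec (If e c1 c2) s (1 + cost e + t) s'"
| WhileFalse: "val e s = Leaf \<Longrightarrow> exec (While e c) s (1 + cost e) s"
| WhileTrue: "val e s \<noteq> Leaf \<Longrightarrow> exec c s t1 s1 \<Longrightarrow> exec (While e c) s1 t2 s2 \<Longrightarrow>
    exec (While e c) s (1 + cost e + t1 + t2) s2"

text \<open>Input and output are in register 0; all other registers are initially empty.\<close>

definition init_store :: "tree \<Rightarrow> store" where
  "init_store d = (\<lambda>_. Leaf)(0 := d)"

definition outputs :: "com \<Rightarrow> tree \<Rightarrow> tree \<Rightarrow> bool" where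
  "outputs p d d' \<longleftrightarrow> (\<exists>t s'. exec p (init_store d) t s' \<and> s' 0 = d')"

definition accepts :: "com \<Rightarrow> tree \<Rightarrow> bool" where
  "accepts p d \<longleftrightarrow> (\<exists>d'. outputs p d d' \<and> d' \<noteq> Leaf)"

definition rejects :: "com \<Rightarrow> tree \<Rightarrow> bool" where
  "rejects p d \<longleftrightarrow> outputs p d Leaf"

definition halts_within :: "com \<Rightarrow> tree \<Rightarrow> real \<Rightarrow> bool" where
  "halts_within p d T \<longleftrightarrow> (\<exists>t s'. exec p (init_store d) t s' \<and> real t \<le> T)"

fun enc_nat :: "nat \<Rightarrow> tree" where
  "enc_nat 0 = Leaf"
| "enc_nat (Suc n) = Node Leaf (enc_nat n)"

fun enc_list :: "('b \<Rightarrow> tree) \<Rightarrow> 'b list \<Rightarrow> tree" where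
  "enc_list e [] = Leaf"
| "enc_list e (x # xs) = Node (e x) (enc_list e xs)"

fun enc_pair :: "('b \<Rightarrow> tree) \<Rightarrow> ('c \<Rightarrow> tree) \<Rightarrow> 'b \<times> 'c \<Rightarrow> tree" where
  "enc_pair e e' (x, y) = Node (e x) (e' y)"

definition computable :: "(nat \<Rightarrow> nat) \<Rightarrow> bool" where
  "computable f \<longleftrightarrow> (\<exists>p. \<forall>n. outputs p (enc_nat n) (enc_nat (f n)))"

text \<open>Executions are deterministic, so a program never both accepts and rejects an input.\<close>

inductive_cases SkipE: "exec Skip s t s'"
inductive_cases AssignE: "exec (Assign x e) s t s'"
inductive_cases SeqE: "exec (Seq c1 c2) s t s'"
inductive_cases IfE: "exec (If e c1 c2) s t s'"
inductive_cases WhileE: "exec (While e c) s t s'"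

lemma exec_deterministic:
  "exec c s t s' \<Longrightarrow> exec c s u s'' \<Longrightarrow> u = t \<and> s'' = s'"
proof (induction arbitrary: u s'' rule: exec.induct)
  case Skip
  then show ?case by (auto elim: SkipE)
next
  case Assign
  then show ?case by (auto elim: AssignE)
next
  case (Seq c1 s t1 s1 c2 t2 s2)
  from Seq.prems show ?case
    by (rule SeqE) (auto dest!: Seq.IH)
next
  case (IfTrue e s c1 t s' c2)
  from IfTrue.prems show ?case
    by (rule IfE) (use IfTrue.hyps(1) in \<open>auto dest!: IfTrue.IH\<close>)
next
  case (IfFalse e s c2 t s' c1)
  from IfFalse.prems show ?case
    by (rule IfE) (use IfFalse.hyps(1) in \<open>auto dest!: IfFalse.IH\<close>)
next
  case (WhileFalse e s c)
  from WhileFalse.prems show ?case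
    by (rule WhileE) (use WhileFalse.hyps in auto)
next
  case (WhileTrue e s c t1 s1 t2 s2)
  from WhileTrue.prems show ?case
    by (rule WhileE) (use WhileTrue.hyps(1) in \<open>auto dest!: WhileTrue.IH\<close>)
qed


section \<open>2CSP instances as inputs\<close>

text \<open>
  The input \<open>(ds, cs)\<close> describes the instance with variables \<open>0, \<dots>, length ds - 1\<close>, where variable
  \<open>x\<close> has domain \<open>{0, \<dots>, ds ! x - 1}\<close>, and with constraint list \<open>cs\<close>, each relation being a list
  of pairs.
\<close>

type_synonym csp_input = "nat list \<times> ((nat \<times> nat) \<times> (nat \<times> nat) list) list"

fun csp_of :: "csp_input \<Rightarrow> (nat, nat) csp" where
  "csp_of (ds, cs) =
     \<lparr>vars = {..<length ds}, vdom = (\<lambda>x. {..<ds ! x}), constrs = (\<lambda>(w, R). (w, set R)) ` set cs\<rparr>"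

fun enc_input :: "csp_input \<Rightarrow> tree" where
  "enc_input (ds, cs) =
     Node (enc_list enc_nat ds)
       (enc_list (enc_pair (enc_pair enc_nat enc_nat) (enc_list (enc_pair enc_nat enc_nat))) cs)"

text \<open>
  Nothing is listed twice, and each ordered pair of variables carries at most one relation, so
  that the size of the input is polynomial in the number of variables and the alphabet size.
  Otherwise there could be exponentially many constraints on a single pair, and no time bound in
  terms of these two parameters alone would allow reading the input.  The alphabet size is
  required to be positive, since a bound of the form \<open>f(k) n^C\<close> is void for \<open>n = 0\<close>.
\<close>

fun valid_input :: "csp_input \<Rightarrow> bool" where
  "valid_input (ds, cs) \<longleftrightarrow>
     is_csp (csp_of (ds, cs)) \<and> distinct (map fst cs) \<and> (\<forall>(w, R) \<in> set cs. distinct R) \<and>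
     num_vars (csp_of (ds, cs)) \<ge> 1 \<and> alphabet_size (csp_of (ds, cs)) \<ge> 1"

definition runs_in_time :: "com \<Rightarrow> (nat \<Rightarrow> nat \<Rightarrow> real) \<Rightarrow> bool" where
  "runs_in_time p T \<longleftrightarrow>
     (\<forall>I. valid_input I \<longrightarrow>
        halts_within p (enc_input I) (T (num_vars (csp_of I)) (alphabet_size (csp_of I))))"

definition decides_csp :: "com \<Rightarrow> bool" where
  "decides_csp p \<longleftrightarrow>
     (\<forall>I. valid_input I \<longrightarrow>
        (satisfiable (csp_of I) \<longrightarrow> accepts p (enc_input I)) \<and>
        (\<not> satisfiable (csp_of I) \<longrightarrow> rejects p (enc_input I)))"

definition distinguishes_list_csp :: "nat \<Rightarrow> com \<Rightarrow> bool" where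
  "distinguishes_list_csp r p \<longleftrightarrow>
     (\<forall>I. valid_input I \<longrightarrow>
        (satisfiable (csp_of I) \<longrightarrow> accepts p (enc_input I)) \<and>
        (\<not> list_satisfiable r (csp_of I) \<longrightarrow> rejects p (enc_input I)))"

text \<open>The hypothesis \<open>W[1] \<noteq> FPT\<close>, in its equivalent form for 2CSP parameterized by the number of
  variables.\<close>

definition W1_neq_FPT :: bool where
  "W1_neq_FPT \<longleftrightarrow>
     (\<forall>f. computable f \<longrightarrow>
        \<not> (\<exists>p c. decides_csp p \<and> runs_in_time p (\<lambda>k n. real (f k) * real n ^ c)))"

end

theory Submission
  imports Defs
begin

text \<open>
  For a constant \<open>t\<close>, a 2CSP instance is turned into its \<open>t\<close>-fold direct power: the variables are the
  \<open>t\<close>-tuples of variables, the values are the \<open>t\<close>-tuples of values, and a pair of tuples is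
  constrained to carry one consistent partial solution of the original instance.  A solution induces
  a solution of the power.  Conversely, an \<open>r\<close>-list assignment of the power attaches to every small
  set of variables at most \<open>r\<close> partial solutions.  For any few small sets there is a single family of
  \<open>r\<close> functions, namely the list of their union, which agrees on each of these sets with a member of
  its list.  If \<open>t\<close> is large in terms of \<open>r\<close>, an induction on the sizes of the lists extracts
  a global solution from this.  The power has \<open>k ^ t\<close> variables and an alphabet of size at most
  \<open>(k * n) ^ t\<close>, and \<open>t\<close> depends on \<open>r\<close> only, so running the assumed algorithm on it decides
  satisfiability in time \<open>f'(k) * n ^ c\<close>.
\<close>

section \<open>Gluing partial functions\<close>

text \<open>The family \<open>z\<close> hits boundedly many sets, while the number of variables is
  unbounded. So \<open>z\<close>, and the entry it uses on a given set, change with the family of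
  sets, and entries on overlapping sets may contradict each other. Colours make such conflicts
  tractable: \<open>z\<close> has one function per colour, so entries of one colour used by the same
  \<open>z\<close> agree wherever their sets meet. The measure of the induction is the number of
  colours plus the length of a list. Each obstruction to gluing lowers it, at the price of replacing
  a set \<open>S\<close> by a larger set above it; this is why the parameters \<open>p\<close> and
  \<open>b\<close> grow along the induction. They are obtained by pure existence, which is enough
  because \<open>t\<close> is hard-wired into the program and never computed. The other difficulty
  is the machine: the reduction has to be an actual program whose cost, reading the input included,
  is polynomial in \<open>k * n\<close>. It is therefore built from operations under which
  polynomial time is closed, above all loops over lists whose bodies see an environment.\<close>

definition hits :: "('v set \<Rightarrow> ('c \<times> ('v \<Rightarrow> 'a)) set) \<Rightarrow> ('c \<Rightarrow> 'v \<Rightarrow> 'a) \<Rightarrow> 'v set \<Rightarrow> bool" where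
  "hits L z S \<longleftrightarrow> (\<exists>(e, w) \<in> L S. \<forall>x \<in> S. z e x = w x)"

definition bounded_family :: "nat \<Rightarrow> nat \<Rightarrow> 'v set set \<Rightarrow> bool" where
  "bounded_family p b F \<longleftrightarrow> finite F \<and> card F \<le> p \<and> (\<forall>S \<in> F. finite S \<and> card S \<le> b)"

text \<open>The order of quantifiers matters: \<open>z\<close> may depend on \<open>F\<close>. With
  finitely many colours, a single \<open>z\<close> hitting all finite sets would already have a
  component that covers \<open>L\<close>.\<close>

definition hittable :: "nat \<Rightarrow> nat \<Rightarrow> ('v set \<Rightarrow> ('c \<times> ('v \<Rightarrow> 'a)) set) \<Rightarrow> bool" where
  "hittable p b L \<longleftrightarrow> (\<forall>F. bounded_family p b F \<longrightarrow> (\<exists>z. \<forall>S \<in> F. hits L z S))"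

text \<open>Two points are enough because constraints are binary. The size of \<open>T\<close> is
  left free, so that lists may be moved to larger sets.\<close>

definition covers :: "('v set \<Rightarrow> ('c \<times> ('v \<Rightarrow> 'a)) set) \<Rightarrow> ('v \<Rightarrow> 'a) \<Rightarrow> bool" where
  "covers L \<sigma> \<longleftrightarrow>
     (\<forall>W. finite W \<and> card W \<le> 2 \<longrightarrow> (\<exists>T. \<exists>(e, w) \<in> L T. W \<subseteq> T \<and> (\<forall>x \<in> W. \<sigma> x = w x)))"

text \<open>The sum \<open>card E + card (L T)\<close> is the induction measure: it drops when every
  list loses an entry and also when \<open>E\<close> loses a colour.\<close>

definition small_lists :: "nat \<Rightarrow> 'c set \<Rightarrow> ('v set \<Rightarrow> ('c \<times> ('v \<Rightarrow> 'a)) set) \<Rightarrow> bool" where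
  "small_lists n E L \<longleftrightarrow>
     finite E \<and> (\<forall>T. finite (L T) \<and> fst ` L T \<subseteq> E \<and> card E + card (L T) \<le> n)"

lemma hitsI: "(e, w) \<in> L S \<Longrightarrow> (\<And>x. x \<in> S \<Longrightarrow> z e x = w x) \<Longrightarrow> hits L z S"
  unfolding hits_def by blast

lemma hitsE:
  assumes "hits L z S"
  obtains e w where "(e, w) \<in> L S" "\<forall>x \<in> S. z e x = w x"
  using assms unfolding hits_def by blast

lemma hittableD:
  "hittable p b L \<Longrightarrow> bounded_family p b F \<Longrightarrow> \<exists>z. \<forall>S \<in> F. hits L z S"
  by (simp add: hittable_def)

text \<open>The induction hypothesis is applied to lists indexed by \<open>S\<close> but drawn from
  a larger set \<open>T S\<close>. What covers them covers \<open>L\<close>: an entry used for some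
  \<open>W\<close> inside \<open>S\<close> is an entry of \<open>L (T S)\<close>, and
  \<open>T S\<close> contains \<open>W\<close> as well.\<close>

lemma covers_by_sublists:
  fixes L :: "'v set \<Rightarrow> ('c \<times> ('v \<Rightarrow> 'a)) set"
  assumes IH: "\<And>(E :: 'c set) (L' :: 'v set \<Rightarrow> ('c \<times> ('v \<Rightarrow> 'a)) set). small_lists n E L' \<Longrightarrow> hittable p b L' \<Longrightarrow> \<exists>\<sigma> :: 'v \<Rightarrow> 'a. covers L' \<sigma>"
    and "finite E" "card E \<le> n"
    and sub: "\<And>S. finite S \<Longrightarrow> card S \<le> b \<Longrightarrow>
      S \<subseteq> T S \<and> M S \<subseteq> L (T S) \<and> finite (M S) \<and> fst ` M S \<subseteq> E \<and> card E + card (M S) \<le> n"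
    and hit: "\<And>F. bounded_family p b F \<Longrightarrow> \<exists>z. \<forall>S \<in> F. hits M z S"
  shows "\<exists>\<sigma>. covers L \<sigma>"
proof -
  define M' where "M' S = (if finite S \<and> card S \<le> b then M S else {})" for S
  have "small_lists n E M'"
    using assms(2,3) sub by (auto simp: small_lists_def M'_def)
  moreover have "hittable p b M'"
    unfolding hittable_def
  proof (intro allI impI)
    fix F :: "'v set set" assume F: "bounded_family p b F"
    from hit[OF F] obtain z where "\<forall>S \<in> F. hits M z S" by blast
    with F show "\<exists>z. \<forall>S \<in> F. hits M' z S"
      by (intro exI[of _ z]) (auto simp: hits_def M'_def bounded_family_def)
  qed
  ultimately obtain \<sigma> :: "'v \<Rightarrow> 'a" where \<sigma>: "covers M' \<sigma>" using IH by blast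
  have "covers L \<sigma>"
    unfolding covers_def
  proof (intro allI impI)
    fix W :: "'v set" assume "finite W \<and> card W \<le> 2"
    with \<sigma> obtain S e w where S: "(e, w) \<in> M' S" "W \<subseteq> S" "\<forall>x \<in> W. \<sigma> x = w x"
      unfolding covers_def by blast
    then have "finite S" "card S \<le> b" "(e, w) \<in> M S" by (auto simp: M'_def split: if_splits)
    with sub[of S] S(2) have "(e, w) \<in> L (T S)" "W \<subseteq> T S" by auto
    with S(3) show "\<exists>T. \<exists>(e, w) \<in> L T. W \<subseteq> T \<and> (\<forall>x \<in> W. \<sigma> x = w x)"
      by (intro exI[of _ "T S"] bexI[of _ "(e, w)"]) auto
  qed
  then show ?thesis by blast
qed

lemma bounded_family_image:
  assumes "bounded_family p b F" "\<And>S. finite S \<Longrightarrow> card S \<le> b \<Longrightarrow> finite (T S) \<and> card (T S) \<le> B" "p \<le> q"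
  shows "bounded_family q B (T ` F)"
  using assms card_image_le[of F T] by (fastforce simp: bounded_family_def)

text \<open>Entries \<open>(e, w)\<close> of the lists come with a colour \<open>e\<close>.  Either entries can be discarded from all
  lists above a cofinal family of sets, or a colour disappears, or the entries of some colour are
  consistent and glue to the required function.\<close>

lemma ex_cover:
  "\<exists>p b. \<forall>E (L :: 'v set \<Rightarrow> ('c \<times> ('v \<Rightarrow> 'a)) set). small_lists n E L \<longrightarrow> hittable p b L \<longrightarrow> (\<exists>\<sigma>. covers L \<sigma>)"
proof (induction n)
  case 0
  \<comment> \<open>An empty list cannot be hit, so the family whose only member is the empty set
    refutes hittability.\<close>
  have "\<not> hittable 1 0 L" if "small_lists 0 E L" for E and L :: "'v set \<Rightarrow> ('c \<times> ('v \<Rightarrow> 'a)) set"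
  proof
    assume "hittable 1 0 L"
    then obtain z where "\<forall>S \<in> {{}}. hits L z S"
      using hittableD[of 1 0 L "{{}}"] by (auto simp: bounded_family_def)
    moreover have "L {} = {}" using that unfolding small_lists_def by (metis card_0_eq add_is_0 le_zero_eq)
    ultimately show False by (simp add: hits_def)
  qed
  then show ?case by blast
next
  case (Suc n)
  then obtain p b where IH: "\<And>E (L :: 'v set \<Rightarrow> ('c \<times> ('v \<Rightarrow> 'a)) set). small_lists n E L \<Longrightarrow> hittable p b L \<Longrightarrow> \<exists>\<sigma>. covers L \<sigma>"
    by blast
  \<comment> \<open>\<open>b2\<close> has room for a set of size \<open>b\<close> and two points for
    each of at most \<open>Suc n\<close> colours. \<open>B\<close> bounds \<open>b2\<close> and also
    three sets of size \<open>b\<close> with a point. \<open>q\<close> is at least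
    \<open>p + p * p\<close>, that is, \<open>p\<close> sets with a family of \<open>p\<close> sets
    for each.\<close>
  define b2 where "b2 = b + 2 * Suc n"
  define B where "B = 3 * b + 1 + b2"
  define q where "q = (p + 1) * (p + 1)"
  have "\<exists>\<sigma>. covers L \<sigma>" if sl: "small_lists (Suc n) E L" and H: "hittable q B L"
    for E and L :: "'v set \<Rightarrow> ('c \<times> ('v \<Rightarrow> 'a)) set"
  proof -
    have fin: "finite E" "\<And>T. finite (L T)" and LE: "\<And>T. fst ` L T \<subseteq> E"
      and cd: "\<And>T. card E + card (L T) \<le> Suc n"
      using sl by (auto simp: small_lists_def)
    \<comment> \<open>One entry is discarded above each small set. This is used twice, with
      different reasons why the discarded entry can be avoided when hitting.\<close>
    have removal: "\<exists>\<sigma>. covers L \<sigma>"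
      if S: "\<And>S. finite S \<Longrightarrow> card S \<le> b \<Longrightarrow> S \<subseteq> T S \<and> y S \<in> L (T S)"
        and h: "\<And>F. bounded_family p b F \<Longrightarrow> \<exists>z. \<forall>S \<in> F. hits (\<lambda>S. L (T S) - {y S}) z S"
      for T y
    proof (rule covers_by_sublists[OF IH, where E = E and T = T and M = "\<lambda>S. L (T S) - {y S}"])
      show "finite E" by fact
      \<comment> \<open>Where lists are empty, \<open>small_lists n\<close> still asks for
        \<open>card E \<le> n\<close>; the presence of one nonempty list supplies this.\<close>
      have "card (L (T {})) > 0" using S[of "{}"] fin(2) card_gt_0_iff by auto
      then show "card E \<le> n" using cd[of "T {}"] by linarith
      fix S :: "'v set" assume S': "finite S" "card S \<le> b"
      have "card (L (T S)) = Suc (card (L (T S) - {y S}))"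
        using S[OF S'] fin(2) by (metis card_Suc_Diff1)
      then show "S \<subseteq> T S \<and> L (T S) - {y S} \<subseteq> L (T S) \<and> finite (L (T S) - {y S}) \<and>
         fst ` (L (T S) - {y S}) \<subseteq> E \<and> card E + card (L (T S) - {y S}) \<le> n"
        using S[OF S'] fin(2)[of "T S"] LE[of "T S"] cd[of "T S"] by auto
    qed (use h in auto)
    \<comment> \<open>\<open>F\<close> is a witness that can be added to any family that has to be
      hit; after that \<open>(e, w)\<close> is no longer available as the entry used on
      \<open>T\<close>.\<close>
    define dead where "dead T e w F \<longleftrightarrow> bounded_family p B F \<and>
      (\<forall>z. (\<forall>S \<in> F. hits L z S) \<longrightarrow> \<not> (\<forall>x \<in> T. z e x = w x))" for T e w F
    show ?thesis
    proof (cases "\<forall>S. finite S \<and> card S \<le> b \<longrightarrow>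
        (\<exists>T y F. S \<subseteq> T \<and> finite T \<and> card T \<le> b2 \<and> y \<in> L T \<and> dead T (fst y) (snd y) F)")
      case True
      then obtain T y F where *: "\<And>S. finite S \<Longrightarrow> card S \<le> b \<Longrightarrow> S \<subseteq> T S \<and> finite (T S) \<and>
          card (T S) \<le> b2 \<and> y S \<in> L (T S) \<and> dead (T S) (fst (y S)) (snd (y S)) (F S)"
        by metis
      show ?thesis
      proof (rule removal[of T y])
        \<comment> \<open>To hit \<open>G\<close> through the shortened lists, the sets
          \<open>T S\<close> are hit together with all their witness families
          \<open>F S\<close>.\<close>
        fix G :: "'v set set" assume G: "bounded_family p b G"
        have G': "finite G" "card G \<le> p" "\<And>S. S \<in> G \<Longrightarrow> finite S \<and> card S \<le> b"
          using G by (auto simp: bounded_family_def)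
        have F: "bounded_family p B (F S)" if "S \<in> G" for S
          using * G'(3)[OF that] by (simp add: dead_def)
        have "card (T ` G \<union> (\<Union>S \<in> G. F S)) \<le> card (T ` G) + card (\<Union>S \<in> G. F S)"
          by (rule card_Un_le)
        also have "card (T ` G) \<le> p" using card_image_le[OF G'(1)] G'(2) le_trans by blast
        also have "card (\<Union>S \<in> G. F S) \<le> (\<Sum>S \<in> G. card (F S))" by (rule card_UN_le[OF G'(1)])
        also have "\<dots> \<le> (\<Sum>S \<in> G. p)" using F by (intro sum_mono) (simp add: bounded_family_def)
        also have "\<dots> \<le> p * p" using G'(2) by simp
        finally have "card (T ` G \<union> (\<Union>S \<in> G. F S)) \<le> q" by (simp add: q_def)
        moreover have "finite (T ` G \<union> (\<Union>S \<in> G. F S))" using G'(1) F by (auto simp: bounded_family_def)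
        moreover have "finite S \<and> card S \<le> B" if "S \<in> T ` G \<union> (\<Union>S \<in> G. F S)" for S
        proof -
          have "b2 \<le> B" by (simp add: B_def)
          then show ?thesis using that F *[OF conjunct1[OF G'(3)] conjunct2[OF G'(3)]] by (auto simp: bounded_family_def intro: le_trans)
        qed
        ultimately have TG: "bounded_family q B (T ` G \<union> (\<Union>S \<in> G. F S))"
          by (simp add: bounded_family_def)
        from hittableD[OF H TG] obtain z where z': "\<forall>S \<in> T ` G \<union> (\<Union>S \<in> G. F S). hits L z S" ..
        then have z: "hits L z (T S)" "\<forall>S' \<in> F S. hits L z S'" if "S \<in> G" for S
          using that by auto
        have "hits (\<lambda>S. L (T S) - {y S}) z S" if SG: "S \<in> G" for S
        proof -
          obtain e w where ew: "(e, w) \<in> L (T S)" "\<forall>x \<in> T S. z e x = w x"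
            using z(1)[OF SG] by (rule hitsE)
          have "\<not> (\<forall>x \<in> T S. z (fst (y S)) x = snd (y S) x)"
          proof -
            have "dead (T S) (fst (y S)) (snd (y S)) (F S)" using *[of S] G'(3)[OF SG] by simp
            with z(2)[OF SG] show ?thesis unfolding dead_def by blast
          qed
          then have "(e, w) \<noteq> y S" using ew(2) by (metis fst_conv snd_conv)
          moreover have "S \<subseteq> T S" using * G'(3)[OF SG] by simp
          ultimately show ?thesis using ew by (intro hitsI[of e w]) auto
        qed
        then show "\<exists>z. \<forall>S \<in> G. hits (\<lambda>S. L (T S) - {y S}) z S" by blast
      qed (use * in auto)
    next
      case False
      \<comment> \<open>Above \<open>W0\<close> no entry on a set of size at most \<open>b2\<close>
        is dead: any \<open>p\<close> sets of size at most \<open>B\<close> are hit by some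
        \<open>z\<close> that extends the entry.\<close>
      then obtain W0 where W0: "finite W0" "card W0 \<le> b"
        and alive: "\<And>T e w F. W0 \<subseteq> T \<Longrightarrow> finite T \<Longrightarrow> card T \<le> b2 \<Longrightarrow> (e, w) \<in> L T \<Longrightarrow> \<not> dead T e w F"
        by (metis fst_conv snd_conv)
      show ?thesis
      proof (cases "\<exists>T e w. W0 \<subseteq> T \<and> finite T \<and> card T \<le> b2 \<and> (e, w) \<in> L T \<and>
          (\<forall>S. finite S \<and> card S \<le> b \<longrightarrow>
            (\<exists>V u. S \<subseteq> V \<and> finite V \<and> card V \<le> B \<and> (e, u) \<in> L V \<and> (\<exists>x \<in> T \<inter> V. u x \<noteq> w x)))")
        case True
        then obtain T e w where T: "W0 \<subseteq> T" "finite T" "card T \<le> b2" "(e, w) \<in> L T"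
          and ex: "\<forall>S. finite S \<and> card S \<le> b \<longrightarrow>
            (\<exists>V u. S \<subseteq> V \<and> finite V \<and> card V \<le> B \<and> (e, u) \<in> L V \<and> (\<exists>x \<in> T \<inter> V. u x \<noteq> w x))"
          by (elim exE conjE) (rule that)
        from ex obtain V u where V: "\<And>S. finite S \<Longrightarrow> card S \<le> b \<Longrightarrow> S \<subseteq> V S \<and> finite (V S) \<and>
            card (V S) \<le> B \<and> (e, u S) \<in> L (V S) \<and> (\<exists>x \<in> T \<inter> V S. u S x \<noteq> w x)"
          by metis
        show ?thesis
        \<comment> \<open>Since \<open>(e, w)\<close> is alive, some \<open>z\<close> hits all the
          sets \<open>V S\<close> and has \<open>z e\<close> equal to \<open>w\<close> on
          \<open>T\<close>. It differs from \<open>u S\<close> at a common point, so the entry used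
          on \<open>V S\<close> is not \<open>(e, u S)\<close>.\<close>
        proof (rule removal[of V "\<lambda>S. (e, u S)"])
          fix F :: "'v set set" assume F: "bounded_family p b F"
          have "bounded_family p B (V ` F)"
            by (rule bounded_family_image[OF F]) (use V in auto)
          then obtain z where z: "\<And>S. S \<in> F \<Longrightarrow> hits L z (V S)" "\<forall>x \<in> T. z e x = w x"
            using alive[OF T, of "V ` F"] by (auto simp: dead_def)
          have "hits (\<lambda>S. L (V S) - {(e, u S)}) z S" if SF: "S \<in> F" for S
          proof -
            have S: "finite S" "card S \<le> b" using F that by (auto simp: bounded_family_def)
            obtain e' w' where ew: "(e', w') \<in> L (V S)" "\<forall>x \<in> V S. z e' x = w' x"
              using z(1)[OF SF] by (rule hitsE)
            have "(e', w') \<noteq> (e, u S)" using V[OF S] ew(2) z(2) by auto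
            moreover have "S \<subseteq> V S" using V[OF S] by simp
            ultimately show ?thesis using ew by (intro hitsI[of e' w']) auto
          qed
          then show "\<exists>z. \<forall>S \<in> F. hits (\<lambda>S. L (V S) - {(e, u S)}) z S" by blast
        qed (use V in auto)
      next
        case False
        \<comment> \<open>Every entry above \<open>W0\<close> now has a set \<open>Z\<close> above
          which its colour is rigid: no entry of colour \<open>e\<close> on a set of size at most
          \<open>B\<close> contradicts \<open>w\<close>.\<close>
        have stable: "\<exists>Z. finite Z \<and> card Z \<le> b \<and> (\<forall>V u. Z \<subseteq> V \<and> finite V \<and> card V \<le> B \<and> (e, u) \<in> L V \<longrightarrow>
            (\<forall>x \<in> T \<inter> V. u x = w x))"
          if "W0 \<subseteq> T" "finite T" "card T \<le> b2" "(e, w) \<in> L T" for T e w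
        proof (rule ccontr)
          assume "\<not> ?thesis"
          then have *: "\<forall>S. finite S \<and> card S \<le> b \<longrightarrow>
            (\<exists>V u. S \<subseteq> V \<and> finite V \<and> card V \<le> B \<and> (e, u) \<in> L V \<and> (\<exists>x \<in> T \<inter> V. u x \<noteq> w x))"
            by simp
          show False
            by (rule notE[OF False], rule exI[of _ T], rule exI[of _ e], rule exI[of _ w])
              (intro conjI that *)
        qed
        show ?thesis
        proof (cases "\<exists>e w w' x T T'. W0 \<subseteq> T \<and> finite T \<and> card T \<le> b2 \<and> (e, w) \<in> L T \<and>
            W0 \<subseteq> T' \<and> finite T' \<and> card T' \<le> b2 \<and> (e, w') \<in> L T' \<and> x \<in> T \<inter> T' \<and> w x \<noteq> w' x")
          case True
          then obtain e w w' x T T' where T: "W0 \<subseteq> T" "finite T" "card T \<le> b2" "(e, w) \<in> L T"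
            and T': "W0 \<subseteq> T'" "finite T'" "card T' \<le> b2" "(e, w') \<in> L T'"
            and x: "x \<in> T \<inter> T'" "w x \<noteq> w' x" by (elim exE conjE) (rule that)
          from stable[OF T] obtain Z where Z: "finite Z" "card Z \<le> b"
            "\<forall>V u. Z \<subseteq> V \<and> finite V \<and> card V \<le> B \<and> (e, u) \<in> L V \<longrightarrow> (\<forall>x \<in> T \<inter> V. u x = w x)"
            by (elim exE conjE) (rule that)
          from stable[OF T'] obtain Z' where Z': "finite Z'" "card Z' \<le> b"
            "\<forall>V u. Z' \<subseteq> V \<and> finite V \<and> card V \<le> B \<and> (e, u) \<in> L V \<longrightarrow> (\<forall>x \<in> T' \<inter> V. u x = w' x)"
            by (elim exE conjE) (rule that)
          \<comment> \<open>Above \<open>Z\<close> and \<open>Z'\<close> an entry of colour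
            \<open>e\<close> would have to take both values \<open>w x\<close> and
            \<open>w' x\<close> at \<open>x\<close>. So the lists of the sets \<open>V S\<close>
            avoid colour \<open>e\<close>, and it can be deleted from \<open>E\<close>.\<close>
          define V where "V S = S \<union> (Z \<union> (Z' \<union> {x}))" for S
          have V: "finite (V S) \<and> card (V S) \<le> B" if "finite S" "card S \<le> b" for S
          proof -
            have "card (V S) \<le> card S + (card Z + (card Z' + card {x}))"
              unfolding V_def by (meson card_Un_le add_mono le_trans order_refl)
            then show ?thesis using that Z Z' by (simp add: V_def B_def)
          qed
          have gone: "e' \<noteq> e" if "(e', u) \<in> L (V S)" "finite S" "card S \<le> b" for e' u S
          proof
            assume e': "e' = e"
            have *: "Z \<subseteq> V S" "Z' \<subseteq> V S" "x \<in> V S" by (auto simp: V_def)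
            from e' that(1) have u: "(e, u) \<in> L (V S)" by simp
            have "u x = w x" "u x = w' x"
              using Z(3)[rule_format, of "V S" u x] Z'(3)[rule_format, of "V S" u x] V[OF that(2,3)] u * x(1) by auto
            with x(2) show False by simp
          qed
          have eE: "e \<in> E" using T(4) LE by force
          then have cE: "card E = Suc (card (E - {e}))" using fin(1) by (metis card_Suc_Diff1)
          show ?thesis
          proof (rule covers_by_sublists[OF IH, where E = "E - {e}" and T = V and M = "\<lambda>S. L (V S)"])
            show "finite (E - {e})" using fin(1) by simp
            show "card (E - {e}) \<le> n" using cE cd[of T] by linarith
            show "S \<subseteq> V S \<and> L (V S) \<subseteq> L (V S) \<and> finite (L (V S)) \<and> fst ` L (V S) \<subseteq> E - {e} \<and>
               card (E - {e}) + card (L (V S)) \<le> n" if "finite S" "card S \<le> b" for S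
            proof -
              have "S \<subseteq> V S" by (auto simp: V_def)
              moreover have "fst ` L (V S) \<subseteq> E - {e}"
                using gone[OF _ that] LE[of "V S"] by force
              ultimately show ?thesis using fin(2) cE cd[of "V S"] by simp
            qed
            fix F :: "'v set set" assume F: "bounded_family p b F"
            have "bounded_family q B (V ` F)"
              by (rule bounded_family_image[OF F]) (use V in \<open>auto simp: q_def\<close>)
            from hittableD[OF H this] obtain z where z: "\<And>S. S \<in> F \<Longrightarrow> hits L z (V S)" by blast
            have "hits (\<lambda>S. L (V S)) z S" if SF: "S \<in> F" for S
            proof -
              obtain e' w' where "(e', w') \<in> L (V S)" "\<forall>x \<in> V S. z e' x = w' x"
                using z[OF SF] by (rule hitsE)
              then show ?thesis by (intro hitsI[of e' w']) (auto simp: V_def)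
            qed
            then show "\<exists>z. \<forall>S \<in> F. hits (\<lambda>S. L (V S)) z S" by blast
          qed auto
        next
          case False
          then have cons: "w x = w' x" if "W0 \<subseteq> T" "finite T" "card T \<le> b2" "(e, w) \<in> L T"
            "W0 \<subseteq> T'" "finite T'" "card T' \<le> b2" "(e, w') \<in> L T'" "x \<in> T" "x \<in> T'" for e T T' w w' x
            using False that by (metis IntI)
          \<comment> \<open>If every colour \<open>e\<close> failed at some \<open>W e\<close>, then
            the set \<open>W0\<close> enlarged by all the \<open>W e\<close> would have an empty
            list, although this single set can be hit.\<close>
          have "\<exists>e \<in> E. \<forall>W. finite W \<and> card W \<le> 2 \<longrightarrow>
              (\<exists>T w. W0 \<union> W \<subseteq> T \<and> finite T \<and> card T \<le> b2 \<and> (e, w) \<in> L T)"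
          proof (rule ccontr)
            assume "\<not> ?thesis"
            then obtain W where W: "\<And>e. e \<in> E \<Longrightarrow> finite (W e) \<and> card (W e) \<le> 2"
              and no: "\<And>e T w. e \<in> E \<Longrightarrow> W0 \<union> W e \<subseteq> T \<Longrightarrow> finite T \<Longrightarrow> card T \<le> b2 \<Longrightarrow> (e, w) \<notin> L T"
              by metis
            define T where "T = W0 \<union> (\<Union>e \<in> E. W e)"
            have "card T \<le> card W0 + card (\<Union>e \<in> E. W e)" unfolding T_def by (rule card_Un_le)
            also have "card (\<Union>e \<in> E. W e) \<le> (\<Sum>e \<in> E. card (W e))" by (rule card_UN_le[OF fin(1)])
            also have "\<dots> \<le> (\<Sum>e \<in> E. 2)" using W by (intro sum_mono) simp
            also have "\<dots> \<le> 2 * Suc n" using cd[of T] by simp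
            finally have cT: "card T \<le> b2" using W0 by (simp add: b2_def)
            have fT: "finite T" using W0 W fin(1) by (simp add: T_def)
            have "L T = {}"
            proof (rule ccontr)
              assume "L T \<noteq> {}"
              then obtain e w where ew: "(e, w) \<in> L T" by auto
              then have e: "e \<in> E" using LE by force
              have "W0 \<union> W e \<subseteq> T" using e by (auto simp: T_def)
              from no[OF e this fT cT] ew show False by blast
            qed
            moreover have "bounded_family q B {T}"
              using fT cT by (simp add: bounded_family_def q_def B_def)
            ultimately show False using hittableD[OF H, of "{T}"] by (auto elim: hitsE)
          qed
          then obtain e where e: "\<forall>W. finite W \<and> card W \<le> 2 \<longrightarrow>
              (\<exists>T w. W0 \<union> W \<subseteq> T \<and> finite T \<and> card T \<le> b2 \<and> (e, w) \<in> L T)" ..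
          define P where "P x T w \<longleftrightarrow> W0 \<subseteq> T \<and> finite T \<and> card T \<le> b2 \<and> (e, w) \<in> L T \<and> x \<in> T" for x T w
          \<comment> \<open>By \<open>cons\<close>, all entries of colour \<open>e\<close> above
            \<open>W0\<close> agree at \<open>x\<close>, so \<open>\<sigma>\<close> agrees with each
            of them, whichever one is chosen.\<close>
          define \<sigma> where "\<sigma> x = (SOME a. \<exists>T w. P x T w \<and> a = w x)" for x
          have \<sigma>: "\<sigma> x = w x" if "P x T w" for x T w
          proof -
            have "\<exists>T' w'. P x T' w' \<and> \<sigma> x = w' x"
              unfolding \<sigma>_def by (rule someI_ex) (use that in blast)
            then obtain T' w' where "P x T' w'" "\<sigma> x = w' x" by blast
            with that cons[of T' e w' T w x] show ?thesis by (simp add: P_def)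
          qed
          have "covers L \<sigma>"
            unfolding covers_def
          proof (intro allI impI)
            fix W :: "'v set" assume "finite W \<and> card W \<le> 2"
            from e[rule_format, OF this] obtain T w
              where T: "W0 \<union> W \<subseteq> T" "finite T" "card T \<le> b2" "(e, w) \<in> L T"
              by (elim exE conjE) (rule that)
            then have "P x T w" if "x \<in> W" for x using that by (auto simp: P_def)
            then have "\<sigma> x = w x" if "x \<in> W" for x using that \<sigma> by blast
            with T show "\<exists>T. \<exists>(e, w) \<in> L T. W \<subseteq> T \<and> (\<forall>x \<in> W. \<sigma> x = w x)"
              by (intro exI[of _ T] bexI[of _ "(e, w)"]) auto
          qed
          then show ?thesis by blast
        qed
      qed
    qed
  qed
  then show ?case by blast
qed

section \<open>Polynomial-time functions on trees\<close>

fun nodes :: "tree \<Rightarrow> nat" where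
  "nodes Leaf = 0"
| "nodes (Node a b) = Suc (nodes a + nodes b)"

text \<open>The base is at least 2 even for \<open>n = 0\<close>, so that constants and sums are
  absorbed by the exponent.\<close>

definition poly_bounded :: "(nat \<Rightarrow> nat) \<Rightarrow> bool" where
  "poly_bounded q \<longleftrightarrow> (\<exists>e. \<forall>n. q n \<le> (n + 2) ^ e)"

lemma poly_boundedI: "(\<And>n. q n \<le> (n + 2) ^ e) \<Longrightarrow> poly_bounded q"
  by (auto simp: poly_bounded_def)

lemma poly_bounded_mono: "poly_bounded q \<Longrightarrow> (\<And>n. q' n \<le> q n) \<Longrightarrow> poly_bounded q'"
  unfolding poly_bounded_def by (meson le_trans)

lemma poly_bounded_const: "poly_bounded (\<lambda>_. c)"
proof (rule poly_boundedI)
  fix n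
  have "c \<le> 2 ^ c" by (rule less_imp_le[OF less_exp])
  also have "\<dots> \<le> (n + 2) ^ c" by (rule power_mono) auto
  finally show "c \<le> (n + 2) ^ c" .
qed

lemma poly_bounded_id: "poly_bounded (\<lambda>n. n)"
  by (rule poly_boundedI[of _ 1]) simp

lemma poly_bounded_add:
  assumes "poly_bounded q" "poly_bounded q'"
  shows "poly_bounded (\<lambda>n. q n + q' n)"
proof -
  obtain e e' where e: "\<And>n. q n \<le> (n + 2) ^ e" "\<And>n. q' n \<le> (n + 2) ^ e'"
    using assms by (auto simp: poly_bounded_def)
  show ?thesis
  proof (rule poly_boundedI)
    fix n
    have "q n \<le> (n + 2) ^ (e + e')" "q' n \<le> (n + 2) ^ (e + e')"
      using e[of n] by (auto intro: le_trans power_increasing)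
    then have "q n + q' n \<le> 2 * (n + 2) ^ (e + e')" by simp
    also have "\<dots> \<le> (n + 2) ^ Suc (e + e')" by simp
    finally show "q n + q' n \<le> (n + 2) ^ Suc (e + e')" .
  qed
qed

lemma poly_bounded_mult:
  assumes "poly_bounded q" "poly_bounded q'"
  shows "poly_bounded (\<lambda>n. q n * q' n)"
proof -
  obtain e e' where e: "\<And>n. q n \<le> (n + 2) ^ e" "\<And>n. q' n \<le> (n + 2) ^ e'"
    using assms by (auto simp: poly_bounded_def)
  show ?thesis
    by (rule poly_boundedI[of _ "e + e'"]) (use e in \<open>simp add: power_add mult_mono\<close>)
qed

lemma poly_bounded_power: "poly_bounded q \<Longrightarrow> poly_bounded (\<lambda>n. q n ^ e)"
  by (induction e) (auto intro: poly_bounded_const poly_bounded_mult)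

lemma poly_bounded_comp:
  assumes "poly_bounded q" "poly_bounded q'"
  shows "poly_bounded (\<lambda>n. q (q' n))"
proof -
  obtain e where e: "\<And>n. q n \<le> (n + 2) ^ e"
    using assms by (auto simp: poly_bounded_def)
  have "poly_bounded (\<lambda>n. (q' n + 2) ^ e)"
    by (intro poly_bounded_power poly_bounded_add assms poly_bounded_const)
  then show ?thesis by (rule poly_bounded_mono) (rule e)
qed

lemmas poly_bounded_intros =
  poly_bounded_const poly_bounded_id poly_bounded_add poly_bounded_mult poly_bounded_power

text \<open>The program must work from every initial store and may change only the registers below
  some \<open>m\<close>; a larger program can thus keep its own data in the registers from \<open>m\<close> on.  The size
  of the result is bounded separately, since trees may share subtrees.\<close>

definition ptime_by :: "(tree \<Rightarrow> tree) \<Rightarrow> com \<Rightarrow> nat \<Rightarrow> (nat \<Rightarrow> nat) \<Rightarrow> bool" where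
  "ptime_by F c m q \<longleftrightarrow> m \<ge> 1 \<and> poly_bounded q \<and> mono q \<and>
     (\<forall>s. nodes (F (s 0)) \<le> q (nodes (s 0)) \<and>
       (\<exists>t s'. exec c s t s' \<and> t \<le> q (nodes (s 0)) \<and> s' 0 = F (s 0) \<and> (\<forall>x \<ge> m. s' x = s x)))"

definition ptime :: "(tree \<Rightarrow> tree) \<Rightarrow> bool" where
  "ptime F \<longleftrightarrow> (\<exists>c m q. ptime_by F c m q)"

text \<open>Spares the user monotonicity and positivity: the bound is replaced by the monotone
  \<open>(n + 2) ^ e\<close>, and \<open>m\<close> by \<open>Suc m\<close>.\<close>

lemma ptimeI:
  assumes "poly_bounded q" "\<And>d. nodes (F d) \<le> q (nodes d)"
    and "\<And>s. \<exists>t s'. exec c s t s' \<and> t \<le> q (nodes (s 0)) \<and> s' 0 = F (s 0) \<and> (\<forall>x \<ge> m. s' x = s x)"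
  shows "ptime F"
proof -
  obtain e where e: "\<And>n. q n \<le> (n + 2) ^ e" using assms(1) by (auto simp: poly_bounded_def)
  have "ptime_by F c (Suc m) (\<lambda>n. (n + 2) ^ e)"
    unfolding ptime_by_def
  proof (intro conjI allI)
    show "poly_bounded (\<lambda>n. (n + 2) ^ e)" by (intro poly_bounded_intros)
    show "mono (\<lambda>n::nat. (n + 2) ^ e)" by (intro monoI power_mono) auto
    fix s :: store
    show "nodes (F (s 0)) \<le> (nodes (s 0) + 2) ^ e" using assms(2) e le_trans by blast
    obtain t s' where "exec c s t s'" "t \<le> q (nodes (s 0))" "s' 0 = F (s 0)" "\<forall>x \<ge> m. s' x = s x"
      using assms(3)[of s] by auto
    then show "\<exists>t s'. exec c s t s' \<and> t \<le> (nodes (s 0) + 2) ^ e \<and> s' 0 = F (s 0) \<and> (\<forall>x \<ge> Suc m. s' x = s x)"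
      using e[of "nodes (s 0)"] by (intro exI[of _ t] exI[of _ s']) auto
  qed simp
  then show ?thesis by (auto simp: ptime_def)
qed

lemma ptime_byE:
  assumes "ptime_by F c m q"
  obtains t s' where "exec c s t s'" "t \<le> q (nodes (s 0))" "s' 0 = F (s 0)" "\<And>x. x \<ge> m \<Longrightarrow> s' x = s x"
proof -
  from assms have "\<exists>t s'. exec c s t s' \<and> t \<le> q (nodes (s 0)) \<and> s' 0 = F (s 0) \<and> (\<forall>x \<ge> m. s' x = s x)"
    by (simp add: ptime_by_def)
  then show thesis using that by (elim exE conjE) simp
qed

lemma ptime_by_size: "ptime_by F c m q \<Longrightarrow> nodes (F d) \<le> q (nodes d)"
  unfolding ptime_by_def by (elim conjE allE[of _ "\<lambda>_. d"])

lemma ptime_by_mono: "ptime_by F c m q \<Longrightarrow> i \<le> j \<Longrightarrow> q i \<le> q j"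
  unfolding ptime_by_def by (auto dest: monoD)

lemma ptime_by_poly: "ptime_by F c m q \<Longrightarrow> poly_bounded q"
  unfolding ptime_by_def by blast

lemma ptime_by_pos: "ptime_by F c m q \<Longrightarrow> m \<ge> 1"
  unfolding ptime_by_def by blast

lemma nodes_hd: "nodes (hd_tree d) \<le> nodes d" and nodes_tl: "nodes (tl_tree d) \<le> nodes d"
  by (cases d; simp)+

lemma exec_Assign: "s' = s(x := val e s) \<Longrightarrow> t = Suc (cost e) \<Longrightarrow> exec (Assign x e) s t s'"
  using exec.Assign[of x e s] by simp

lemma exec_Seq: "exec c1 s t1 s1 \<Longrightarrow> exec c2 s1 t2 s2 \<Longrightarrow> t = t1 + t2 \<Longrightarrow> exec (Seq c1 c2) s t s2"
  using exec.Seq by simp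

lemma ptime_id: "ptime (\<lambda>d. d)"
proof (rule ptimeI[of "\<lambda>n. n + 1"])
  show "poly_bounded (\<lambda>n. n + 1)" by (intro poly_bounded_intros)
  show "\<exists>t s'. exec Skip s t s' \<and> t \<le> nodes (s 0) + 1 \<and> s' 0 = s 0 \<and> (\<forall>x \<ge> 0. s' x = s x)" for s
    using exec.Skip by (intro exI[of _ 1] exI[of _ s]) simp
qed simp

lemma ptime_const: "ptime (\<lambda>_. c)"
proof -
  \<comment> \<open>The constant is spelled out as an expression without variables, whose cost
    depends on \<open>c\<close> only.\<close>
  have "\<exists>e. \<forall>s. val e s = c"
  proof (induction c)
    case Leaf
    show ?case by (intro exI[of _ Empty]) simp
  next
    case (Node a b)
    then obtain e e' where "\<forall>s. val e s = a" "\<forall>s. val e' s = b" by auto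
    then show ?case by (intro exI[of _ "Join e e'"]) simp
  qed
  then obtain e where e: "\<And>s. val e s = c" by auto
  show ?thesis
  proof (rule ptimeI[of "\<lambda>n. Suc (cost e) + nodes c"])
    show "\<exists>t s'. exec (Assign 0 e) s t s' \<and> t \<le> Suc (cost e) + nodes c \<and> s' 0 = c \<and> (\<forall>x \<ge> 1. s' x = s x)" for s
      using exec.Assign[of 0 e s] e by (intro exI[of _ "Suc (cost e)"] exI[of _ "s(0 := c)"]) simp
  qed (intro poly_bounded_intros, simp)
qed

lemma ptime_comp:
  assumes "ptime F" "ptime G"
  shows "ptime (\<lambda>d. F (G d))"
proof -
  obtain c m q c' m' q' where F: "ptime_by F c m q" and G: "ptime_by G c' m' q'"
    using assms by (auto simp: ptime_def)
  show ?thesis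
  proof (rule ptimeI[of "\<lambda>n. q' n + q (q' n)"])
    show "poly_bounded (\<lambda>n. q' n + q (q' n))"
      by (intro poly_bounded_add poly_bounded_comp[of q q'] ptime_by_poly[OF F] ptime_by_poly[OF G])
    have le: "q (nodes (G d)) \<le> q (q' (nodes d))" for d
      by (rule ptime_by_mono[OF F ptime_by_size[OF G]])
    show "nodes (F (G d)) \<le> q' (nodes d) + q (q' (nodes d))" for d
      using ptime_by_size[OF F, of "G d"] le[of d] by linarith
    fix s :: store
    obtain t1 s1 where 1: "exec c' s t1 s1" "t1 \<le> q' (nodes (s 0))" "s1 0 = G (s 0)" "\<And>x. x \<ge> m' \<Longrightarrow> s1 x = s x"
      using ptime_byE[OF G] by blast
    obtain t2 s2 where 2: "exec c s1 t2 s2" "t2 \<le> q (nodes (s1 0))" "s2 0 = F (s1 0)" "\<And>x. x \<ge> m \<Longrightarrow> s2 x = s1 x"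
      using ptime_byE[OF F] by blast
    show "\<exists>t s'. exec (Seq c' c) s t s' \<and> t \<le> q' (nodes (s 0)) + q (q' (nodes (s 0))) \<and> s' 0 = F (G (s 0)) \<and> (\<forall>x \<ge> max m m'. s' x = s x)"
      using exec.Seq[OF 1(1) 2(1)] 1(2-) 2(2-) le[of "s 0"] by (intro exI[of _ "t1 + t2"] exI[of _ s2]) auto
  qed
qed

lemma ptime_hd: "ptime F \<Longrightarrow> ptime (\<lambda>d. hd_tree (F d))"
proof (rule ptime_comp[of hd_tree])
  show "ptime hd_tree"
  proof (rule ptimeI[of "\<lambda>n. n + 3"])
    show "\<exists>t s'. exec (Assign 0 (Hd (Var 0))) s t s' \<and> t \<le> nodes (s 0) + 3 \<and> s' 0 = hd_tree (s 0) \<and> (\<forall>x \<ge> 1. s' x = s x)" for s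
      using exec.Assign[of 0 "Hd (Var 0)" s] by (intro exI[of _ 3] exI[of _ "s(0 := hd_tree (s 0))"]) (simp add: numeral_3_eq_3)
  qed (intro poly_bounded_intros, intro trans_le_add1 nodes_hd)
qed

lemma ptime_tl: "ptime F \<Longrightarrow> ptime (\<lambda>d. tl_tree (F d))"
proof (rule ptime_comp[of tl_tree])
  show "ptime tl_tree"
  proof (rule ptimeI[of "\<lambda>n. n + 3"])
    show "\<exists>t s'. exec (Assign 0 (Tl (Var 0))) s t s' \<and> t \<le> nodes (s 0) + 3 \<and> s' 0 = tl_tree (s 0) \<and> (\<forall>x \<ge> 1. s' x = s x)" for s
      using exec.Assign[of 0 "Tl (Var 0)" s] by (intro exI[of _ 3] exI[of _ "s(0 := tl_tree (s 0))"]) (simp add: numeral_3_eq_3)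
  qed (intro poly_bounded_intros, intro trans_le_add1 nodes_tl)
qed

lemma ptime_Node:
  assumes "ptime F" "ptime G"
  shows "ptime (\<lambda>d. Node (F d) (G d))"
proof -
  obtain c m q c' m' q' where F: "ptime_by F c m q" and G: "ptime_by G c' m' q'"
    using assms by (auto simp: ptime_def)
  \<comment> \<open>Register \<open>M\<close> is out of reach of both programs and keeps the input;
    \<open>Suc M\<close> keeps the first result.\<close>
  define M where "M = max m m'"
  have M: "M \<ge> m" "M \<ge> m'" "M \<noteq> 0" using ptime_by_pos[OF F] by (auto simp: M_def)
  define p where "p = Seq (Assign M (Var 0)) (Seq c (Seq (Assign (Suc M) (Var 0)) (Seq (Assign 0 (Var M))
    (Seq c' (Assign 0 (Join (Var (Suc M)) (Var 0)))))))"
  show ?thesis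
  proof (rule ptimeI[of "\<lambda>n. q n + q' n + 20"])
    show "poly_bounded (\<lambda>n. q n + q' n + 20)"
      using F G by (intro poly_bounded_intros) (auto dest: ptime_by_poly)
    show "nodes (Node (F d) (G d)) \<le> q (nodes d) + q' (nodes d) + 20" for d
      using ptime_by_size[OF F, of d] ptime_by_size[OF G, of d] by simp
    fix s :: store
    define s0 where "s0 = s(M := s 0)"
    obtain t1 s1 where 1: "exec c s0 t1 s1" "t1 \<le> q (nodes (s0 0))" "s1 0 = F (s0 0)" "\<And>x. x \<ge> m \<Longrightarrow> s1 x = s0 x"
      using ptime_byE[OF F] by blast
    define s2 where "s2 = (s1(Suc M := s1 0))(0 := s1 M)"
    obtain t3 s3 where 3: "exec c' s2 t3 s3" "t3 \<le> q' (nodes (s2 0))" "s3 0 = G (s2 0)" "\<And>x. x \<ge> m' \<Longrightarrow> s3 x = s2 x"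
      using ptime_byE[OF G] by blast
    have [simp]: "s0 0 = s 0" "s1 M = s 0" "s2 0 = s 0" using M 1(4)[of M] by (simp_all add: s0_def s2_def)
    have "exec p s (2 + (t1 + (2 + (2 + (t3 + 4))))) (s3(0 := Node (s3 (Suc M)) (s3 0)))"
    proof -
      have 0: "exec (Assign M (Var 0)) s 2 s0" by (rule exec_Assign) (auto simp: s0_def)
      have 2: "exec (Assign (Suc M) (Var 0)) s1 2 (s1(Suc M := s1 0))"
        "exec (Assign 0 (Var M)) (s1(Suc M := s1 0)) 2 s2"
        by (rule exec_Assign; simp add: s2_def)+
      have 4: "exec (Assign 0 (Join (Var (Suc M)) (Var 0))) s3 4 (s3(0 := Node (s3 (Suc M)) (s3 0)))"
        by (rule exec_Assign) auto
      show ?thesis unfolding p_def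
        by (rule exec_Seq[OF 0 exec_Seq[OF 1(1) exec_Seq[OF 2(1) exec_Seq[OF 2(2) exec_Seq[OF 3(1) 4]]]]]; rule refl)
    qed
    moreover have F': "s3 (Suc M) = F (s 0)" using 3(4)[of "Suc M"] M 1(3) by (simp add: s2_def)
    moreover have keep: "s3 x = s x" if "x \<ge> Suc (Suc M)" for x
      using that M 3(4)[of x] 1(4)[of x] by (simp add: s2_def s0_def)
    ultimately show "\<exists>t s'. exec p s t s' \<and> t \<le> q (nodes (s 0)) + q' (nodes (s 0)) + 20 \<and> s' 0 = Node (F (s 0)) (G (s 0)) \<and> (\<forall>x \<ge> Suc (Suc M). s' x = s x)"
      using 1(2) 3(2,3)
      by (intro exI[of _ "2 + (t1 + (2 + (2 + (t3 + 4))))"]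
          exI[of _ "s3(0 := Node (s3 (Suc M)) (s3 0))"]) simp
  qed
qed

lemma ptime_If:
  assumes "ptime P" "ptime F" "ptime G"
  shows "ptime (\<lambda>d. if P d = Leaf then G d else F d)"
proof -
  obtain c m q c' m' q' c'' m'' q'' where P: "ptime_by P c m q" and F: "ptime_by F c' m' q'" and G: "ptime_by G c'' m'' q''"
    using assms by (auto simp: ptime_def)
  define M where "M = max m (max m' m'')"
  have M: "M \<ge> m" "M \<ge> m'" "M \<ge> m''" "M \<noteq> 0" using ptime_by_pos[OF F] by (auto simp: M_def)
  define p where "p = Seq (Assign M (Var 0)) (Seq c (Seq (Assign (Suc M) (Var 0)) (Seq (Assign 0 (Var M))
    (If (Var (Suc M)) c' c''))))"
  show ?thesis
  proof (rule ptimeI[of "\<lambda>n. q n + (q' n + q'' n + 20)"])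
    show "poly_bounded (\<lambda>n. q n + (q' n + q'' n + 20))"
      using P F G by (intro poly_bounded_intros) (auto dest: ptime_by_poly)
    show "nodes (if P d = Leaf then G d else F d) \<le> q (nodes d) + (q' (nodes d) + q'' (nodes d) + 20)" for d
      using ptime_by_size[OF F, of d] ptime_by_size[OF G, of d] by simp
    fix s :: store
    define s0 where "s0 = s(M := s 0)"
    obtain t1 s1 where 1: "exec c s0 t1 s1" "t1 \<le> q (nodes (s0 0))" "s1 0 = P (s0 0)" "\<And>x. x \<ge> m \<Longrightarrow> s1 x = s0 x"
      using ptime_byE[OF P] by blast
    define s2 where "s2 = (s1(Suc M := s1 0))(0 := s1 M)"
    have [simp]: "s0 0 = s 0" "s1 M = s 0" "s2 0 = s 0" "s2 (Suc M) = P (s 0)" using M 1(3) 1(4)[of M] by (auto simp: s0_def s2_def)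
    have keep: "s2 x = s x" if "x \<ge> Suc (Suc M)" for x
      using that M 1(4)[of x] by (simp add: s2_def s0_def)
    obtain t3 s3 where 3: "exec (If (Var (Suc M)) c' c'') s2 t3 s3"
      "t3 \<le> 2 + (q' (nodes (s 0)) + q'' (nodes (s 0)))" "s3 0 = (if P (s 0) = Leaf then G (s 0) else F (s 0))" "\<And>x. x \<ge> M \<Longrightarrow> s3 x = s2 x"
    proof (cases "P (s 0) = Leaf")
      case True
      obtain t3 s3 where 3: "exec c'' s2 t3 s3" "t3 \<le> q'' (nodes (s2 0))" "s3 0 = G (s2 0)" "\<And>x. x \<ge> m'' \<Longrightarrow> s3 x = s2 x"
        using ptime_byE[OF G] by blast
      show ?thesis
        by (rule that[OF exec.IfFalse[OF _ 3(1)]]) (use True 3 M in auto)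
    next
      case False
      obtain t3 s3 where 3: "exec c' s2 t3 s3" "t3 \<le> q' (nodes (s2 0))" "s3 0 = F (s2 0)" "\<And>x. x \<ge> m' \<Longrightarrow> s3 x = s2 x"
        using ptime_byE[OF F] by blast
      show ?thesis
        by (rule that[OF exec.IfTrue[OF _ 3(1)]]) (use False 3 M in auto)
    qed
    have "exec p s (2 + (t1 + (2 + (2 + t3)))) s3"
    proof -
      have 0: "exec (Assign M (Var 0)) s 2 s0" by (rule exec_Assign) (auto simp: s0_def)
      have 2: "exec (Assign (Suc M) (Var 0)) s1 2 (s1(Suc M := s1 0))"
        "exec (Assign 0 (Var M)) (s1(Suc M := s1 0)) 2 s2"
        by (rule exec_Assign; simp add: s2_def)+
      show ?thesis unfolding p_def
        by (rule exec_Seq[OF 0 exec_Seq[OF 1(1) exec_Seq[OF 2(1) exec_Seq[OF 2(2) 3(1)]]]]; rule refl)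
    qed
    then show "\<exists>t s'. exec p s t s' \<and> t \<le> q (nodes (s 0)) + (q' (nodes (s 0)) + q'' (nodes (s 0)) + 20) \<and>
        s' 0 = (if P (s 0) = Leaf then G (s 0) else F (s 0)) \<and> (\<forall>x \<ge> Suc (Suc M). s' x = s x)"
      using 1(2) 3(2-) keep by (intro exI[of _ "2 + (t1 + (2 + (2 + t3)))"] exI[of _ s3]) simp
  qed
qed

section \<open>Iteration over lists\<close>

fun tlist :: "tree \<Rightarrow> tree list" where
  "tlist Leaf = []"
| "tlist (Node a b) = a # tlist b"

fun tails :: "tree \<Rightarrow> tree list" where
  "tails Leaf = []"
| "tails (Node a b) = Node a b # tails b"

text \<open>The update receives the whole remaining list and not only its head. The length of what
  remains will serve as the index of the current entry.\<close>

fun sweep :: "(tree \<Rightarrow> 'b \<Rightarrow> 'b) \<Rightarrow> tree \<Rightarrow> 'b \<Rightarrow> 'b" where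
  "sweep u Leaf y = y"
| "sweep u (Node a b) y = sweep u b (u (Node a b) y)"

abbreviation tlen :: "tree \<Rightarrow> nat" where
  "tlen x \<equiv> length (tlist x)"

lemma tlen_le_nodes: "tlen x \<le> nodes x"
  by (induction x) auto

text \<open>For loops that consume the list in register \<open>r\<close>: \<open>st\<close> reads
  the accumulator off the store, \<open>Q\<close> is the invariant, and each pass adds 2 steps for
  the test to the cost of the body.\<close>

lemma exec_sweep:
  assumes body: "\<And>s a b. s r = Node a b \<Longrightarrow> Q s \<Longrightarrow>
      \<exists>t s'. exec c s t s' \<and> t \<le> T \<and> s' r = b \<and> Q s' \<and> st s' = u (Node a b) (st s)"
    and "Q s"
  shows "\<exists>t s'. exec (While (Var r) c) s t s' \<and> t \<le> (T + 2) * tlen (s r) + 2 \<and> Q s' \<and>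
      st s' = sweep u (s r) (st s)"
proof -
  have "s r = x \<Longrightarrow> Q s \<Longrightarrow> ?thesis" for x
  proof (induction x arbitrary: s)
    case Leaf
    then show ?case
      using exec.WhileFalse[of "Var r" s c] by (intro exI[of _ "Suc (Suc 0)"] exI[of _ s]) simp
  next
    case (Node a b)
    obtain t1 s1 where 1: "exec c s t1 s1" "t1 \<le> T" "s1 r = b" "Q s1" "st s1 = u (Node a b) (st s)"
      using body[OF Node.prems] by (elim exE conjE) (rule that)
    obtain t2 s2 where 2: "exec (While (Var r) c) s1 t2 s2" "t2 \<le> (T + 2) * tlen (s1 r) + 2" "Q s2"
      "st s2 = sweep u (s1 r) (st s1)"
      using Node.IH(2)[OF 1(3,4)] by (elim exE conjE) (rule that)
    have "exec (While (Var r) c) s (1 + cost (Var r) + t1 + t2) s2"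
      using Node.prems 1(1) 2(1) by (intro exec.WhileTrue) auto
    then show ?case
      using Node.prems 1 2 by (intro exI[of _ "1 + cost (Var r) + t1 + t2"] exI[of _ s2]) simp
  qed
  then show ?thesis using assms(2) by simp
qed

definition revapp :: "tree \<Rightarrow> tree \<Rightarrow> tree" where
  "revapp = sweep (\<lambda>\<tau> y. Node (hd_tree \<tau>) y)"

text \<open>A list grows only at its front, so the result appears in reverse order. The reversals in
  the sequel stem from this.\<close>

definition collect :: "(tree \<Rightarrow> tree) \<Rightarrow> tree \<Rightarrow> tree" where
  "collect g x = sweep (\<lambda>\<tau>. revapp (g \<tau>)) x Leaf"

text \<open>Truncated subtraction of list lengths, from which all comparisons of numbers are
  derived.\<close>

definition drop_by :: "tree \<Rightarrow> tree \<Rightarrow> tree" where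
  "drop_by = sweep (\<lambda>_. tl_tree)"

lemma nodes_revapp: "nodes (revapp x y) = nodes x + nodes y"
proof -
  have "nodes (sweep (\<lambda>\<tau> y. Node (hd_tree \<tau>) y) x y) = nodes x + nodes y"
    by (induction x arbitrary: y) auto
  then show ?thesis by (simp add: revapp_def)
qed

lemma tlist_revapp: "tlist (revapp x y) = rev (tlist x) @ tlist y"
proof -
  have "tlist (sweep (\<lambda>\<tau> y. Node (hd_tree \<tau>) y) x y) = rev (tlist x) @ tlist y"
    by (induction x arbitrary: y) auto
  then show ?thesis by (simp add: revapp_def)
qed

lemma tlist_collect: "tlist (collect g x) = rev (concat (map (\<lambda>\<tau>. tlist (g \<tau>)) (tails x)))"
proof -
  have "tlist (sweep (\<lambda>\<tau>. revapp (g \<tau>)) x y) = rev (concat (map (\<lambda>\<tau>. tlist (g \<tau>)) (tails x))) @ tlist y" for y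
    by (induction x arbitrary: y) (auto simp: tlist_revapp)
  then show ?thesis by (simp add: collect_def)
qed

lemma nodes_collect:
  assumes "\<And>\<tau>. nodes \<tau> \<le> nodes x \<Longrightarrow> nodes (g \<tau>) \<le> B"
  shows "nodes (collect g x) \<le> nodes x * B"
proof -
  have "nodes (sweep (\<lambda>\<tau>. revapp (g \<tau>)) x' y) \<le> nodes x' * B + nodes y" if "nodes x' \<le> nodes x" for x' y
    using that
  proof (induction x' arbitrary: y)
    case (Node a b)
    have "nodes (sweep (\<lambda>\<tau>. revapp (g \<tau>)) (Node a b) y) \<le> nodes b * B + (nodes (g (Node a b)) + nodes y)"
      using Node.IH(2)[of "revapp (g (Node a b)) y"] Node.prems by (simp add: nodes_revapp)
    also have "nodes (g (Node a b)) \<le> B" using assms Node.prems by blast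
    finally show ?case by (simp add: add_mult_distrib)
  qed simp
  from this[of x Leaf] show ?thesis by (simp add: collect_def)
qed

lemma exec_revapp:
  assumes "r \<noteq> 0"
  shows "\<exists>t s'. exec (While (Var 0) (Seq (Assign r (Join (Hd (Var 0)) (Var r))) (Assign 0 (Tl (Var 0))))) s t s' \<and>
    t \<le> 10 * nodes (s 0) + 2 \<and> s' r = revapp (s 0) (s r) \<and> (\<forall>x. x \<noteq> 0 \<and> x \<noteq> r \<longrightarrow> s' x = s x)"
proof -
  let ?c = "Seq (Assign r (Join (Hd (Var 0)) (Var r))) (Assign 0 (Tl (Var 0)))"
  define Q where "Q s1 \<longleftrightarrow> (\<forall>x. x \<noteq> 0 \<and> x \<noteq> r \<longrightarrow> s1 x = s x)" for s1 :: store
  have "\<exists>t s'. exec (While (Var 0) ?c) s t s' \<and> t \<le> (8 + 2) * tlen (s 0) + 2 \<and> Q s' \<and>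
      s' r = sweep (\<lambda>\<tau> y. Node (hd_tree \<tau>) y) (s 0) (s r)"
  proof (rule exec_sweep[where st = "\<lambda>s. s r" and Q = Q])
    show "Q s" by (simp add: Q_def)
    fix s1 :: store and a b
    assume s1: "s1 0 = Node a b" "Q s1"
    let ?s2 = "s1(r := Node a (s1 r))"
    have 1: "exec (Assign r (Join (Hd (Var 0)) (Var r))) s1 5 ?s2"
      by (rule exec_Assign) (use s1 in auto)
    have 2: "exec (Assign 0 (Tl (Var 0))) ?s2 3 (?s2(0 := b))"
      by (rule exec_Assign) (use s1 assms in auto)
    show "\<exists>t s'. exec ?c s1 t s' \<and> t \<le> 8 \<and> s' 0 = b \<and> Q s' \<and> s' r = Node (hd_tree (Node a b)) (s1 r)"
      using exec.Seq[OF 1 2] s1 assms by (intro exI[of _ 8] exI[of _ "?s2(0 := b)"]) (auto simp: Q_def)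
  qed
  then obtain t s' where "exec (While (Var 0) ?c) s t s'" "t \<le> 10 * tlen (s 0) + 2" "Q s'"
      "s' r = sweep (\<lambda>\<tau> y. Node (hd_tree \<tau>) y) (s 0) (s r)" by (elim exE conjE) simp
  then show ?thesis using tlen_le_nodes[of "s 0"]
    by (intro exI[of _ t] exI[of _ s']) (auto simp: Q_def revapp_def)
qed

text \<open>The loop body sees the input \<open>d\<close> as well as the current tail, the two being
  passed as a pair. This makes loops nestable: the input of an inner loop carries the state of the
  outer ones.\<close>

lemma ptime_collect:
  assumes "ptime F" "ptime (\<lambda>e. G (hd_tree e) (tl_tree e))"
  shows "ptime (\<lambda>d. collect (G d) (F d))"
proof -
  obtain c m q c' m' q' where F: "ptime_by F c m q"
    and G: "ptime_by (\<lambda>e. G (hd_tree e) (tl_tree e)) c' m' q'"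
    using assms by (auto simp: ptime_def)
  define M where "M = max m m'"
  have M: "M \<ge> m" "M \<ge> m'" "M \<noteq> 0" using ptime_by_pos[OF F] by (auto simp: M_def)
  let ?r1 = "Suc M" and ?r2 = "Suc (Suc M)"
  define rl where "rl = While (Var 0) (Seq (Assign ?r2 (Join (Hd (Var 0)) (Var ?r2))) (Assign 0 (Tl (Var 0))))"
  define body where "body = Seq (Assign 0 (Join (Var M) (Var ?r1))) (Seq c' (Seq rl (Assign ?r1 (Tl (Var ?r1)))))"
  define p where "p = Seq (Assign M (Var 0)) (Seq c (Seq (Assign ?r1 (Var 0)) (Seq (Assign ?r2 Empty)
    (Seq (While (Var ?r1) body) (Assign 0 (Var ?r2))))))"
  \<comment> \<open>The pair of \<open>d\<close> and a tail of \<open>F d\<close> has at most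
    \<open>n + q n + 1\<close> nodes.\<close>
  define b where "b n = q' (n + q n + 1)" for n
  have G_size: "nodes (G d \<tau>) \<le> b (nodes d)" if "nodes \<tau> \<le> q (nodes d)" for d \<tau>
  proof -
    have "nodes (G d \<tau>) \<le> q' (nodes (Node d \<tau>))"
      using ptime_by_size[OF G, of "Node d \<tau>"] by simp
    also have "\<dots> \<le> b (nodes d)" unfolding b_def using that by (intro ptime_by_mono[OF G]) simp
    finally show ?thesis .
  qed
  show ?thesis
  proof (rule ptimeI[of "\<lambda>n. q n * b n + (q n + ((11 * b n + 13) * q n + 20))"])
    have "poly_bounded b"
      unfolding b_def
      by (rule poly_bounded_comp[of q'])
        (intro poly_bounded_add poly_bounded_id poly_bounded_const ptime_by_poly[OF F] ptime_by_poly[OF G])+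
    then show "poly_bounded (\<lambda>n. q n * b n + (q n + ((11 * b n + 13) * q n + 20)))"
      using ptime_by_poly[OF F] by (intro poly_bounded_add poly_bounded_mult poly_bounded_const)
    show "nodes (collect (G d) (F d)) \<le> q (nodes d) * b (nodes d) + (q (nodes d) + ((11 * b (nodes d) + 13) * q (nodes d) + 20))" for d
    proof -
      have "nodes (collect (G d) (F d)) \<le> nodes (F d) * b (nodes d)"
        using ptime_by_size[OF F, of d] by (intro nodes_collect G_size) simp
      also have "\<dots> \<le> q (nodes d) * b (nodes d)"
        using ptime_by_size[OF F, of d] by (rule mult_le_mono1)
      finally show ?thesis by simp
    qed
    fix s :: store
    define d where "d = s 0"
    define n where "n = nodes d"
    define s0 where "s0 = s(M := d)"
    obtain t1 s1 where 1: "exec c s0 t1 s1" "t1 \<le> q (nodes (s0 0))" "s1 0 = F (s0 0)" "\<And>x. x \<ge> m \<Longrightarrow> s1 x = s0 x"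
      using ptime_byE[OF F] by blast
    have s0: "s0 0 = d" using M by (simp add: s0_def d_def)
    define s2 where "s2 = s1(?r1 := s1 0)"
    define s3 where "s3 = s2(?r2 := Leaf)"
    define Q where "Q s' \<longleftrightarrow> s' M = d \<and> nodes (s' ?r1) \<le> q n \<and> (\<forall>x > ?r2. s' x = s x)" for s' :: store
    have s3: "s3 ?r1 = F d" "s3 ?r2 = Leaf" using 1(3) s0 by (simp_all add: s3_def s2_def)
    have "Q s3"
      using 1(3) 1(4)[of M] 1(4) M ptime_by_size[OF F, of d] s0
      by (auto simp: Q_def s3_def s2_def n_def s0_def)
    \<comment> \<open>A pass costs at most \<open>b n\<close> for \<open>G\<close> and
      \<open>10 * b n + 2\<close> for moving its result onto the accumulator, besides two
      assignments.\<close>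
    have "\<exists>t s'. exec (While (Var ?r1) body) s3 t s' \<and> t \<le> (11 * b n + 11 + 2) * tlen (s3 ?r1) + 2 \<and> Q s' \<and>
       s' ?r2 = sweep (\<lambda>\<tau>. revapp (G d \<tau>)) (s3 ?r1) (s3 ?r2)"
    proof (rule exec_sweep[where st = "\<lambda>s. s ?r2" and Q = Q])
      show "Q s3" by fact
      fix s4 :: store and a a'
      assume s4: "s4 ?r1 = Node a a'" "Q s4"
      let ?\<tau> = "Node a a'"
      have s4': "s4 M = d" "nodes ?\<tau> \<le> q n" "\<And>x. x > ?r2 \<Longrightarrow> s4 x = s x" using s4 by (auto simp: Q_def)
      let ?s5 = "s4(0 := Node d ?\<tau>)"
      have e5: "exec (Assign 0 (Join (Var M) (Var ?r1))) s4 4 ?s5"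
        by (rule exec_Assign) (use s4 s4' in auto)
      obtain t6 s6 where 6: "exec c' ?s5 t6 s6" "t6 \<le> q' (nodes (?s5 0))"
        "s6 0 = G (hd_tree (?s5 0)) (tl_tree (?s5 0))" "\<And>x. x \<ge> m' \<Longrightarrow> s6 x = ?s5 x"
        using ptime_byE[OF G] by blast
      have t6: "t6 \<le> b n"
      proof -
        have "nodes (?s5 0) \<le> n + q n + 1" using s4'(2) by (simp add: n_def)
        then show ?thesis unfolding b_def using 6(2) ptime_by_mono[OF G] le_trans by blast
      qed
      have g6: "s6 0 = G d ?\<tau>" "nodes (s6 0) \<le> b n"
        using 6(3) G_size[of ?\<tau> d] s4'(2) by (simp_all add: n_def)
      have k6: "s6 M = d" "s6 ?r1 = ?\<tau>" "s6 ?r2 = s4 ?r2" "\<And>x. x > ?r2 \<Longrightarrow> s6 x = s x"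
        using 6(4) M s4 s4' by auto
      obtain t7 s7 where 7: "exec rl s6 t7 s7" "t7 \<le> 10 * nodes (s6 0) + 2" "s7 ?r2 = revapp (s6 0) (s6 ?r2)"
        "\<forall>x. x \<noteq> 0 \<and> x \<noteq> ?r2 \<longrightarrow> s7 x = s6 x"
        using exec_revapp[of ?r2 s6, OF nat.distinct(2), folded rl_def] by (elim exE conjE) (rule that)
      have k7: "s7 M = d" "s7 ?r1 = ?\<tau>" "\<And>x. x > ?r2 \<Longrightarrow> s7 x = s x"
        using 7(4) M k6 by auto
      let ?s8 = "s7(?r1 := a')"
      have e8: "exec (Assign ?r1 (Tl (Var ?r1))) s7 3 ?s8"
        by (rule exec_Assign) (use k7 in auto)
      have "exec body s4 (4 + (t6 + (t7 + 3))) ?s8"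
        unfolding body_def by (rule exec_Seq[OF e5 exec_Seq[OF 6(1) exec_Seq[OF 7(1) e8]]]; rule refl)
      moreover have "4 + (t6 + (t7 + 3)) \<le> 11 * b n + 11" using t6 7(2) g6(2) by linarith
      moreover have "Q ?s8" using k7 s4'(2) by (simp add: Q_def)
      moreover have "?s8 ?r2 = revapp (G d ?\<tau>) (s4 ?r2)" using 7(3) g6(1) k6(3) by simp
      ultimately show "\<exists>t s'. exec body s4 t s' \<and> t \<le> 11 * b n + 11 \<and> s' ?r1 = a' \<and> Q s' \<and>
          s' ?r2 = revapp (G d ?\<tau>) (s4 ?r2)"
        by (intro exI[of _ "4 + (t6 + (t7 + 3))"] exI[of _ ?s8]) simp
    qed
    then obtain t9 s9 where 9: "exec (While (Var ?r1) body) s3 t9 s9"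
      "t9 \<le> (11 * b n + 11 + 2) * tlen (s3 ?r1) + 2" "Q s9"
      "s9 ?r2 = sweep (\<lambda>\<tau>. revapp (G d \<tau>)) (s3 ?r1) (s3 ?r2)"
      by (elim exE conjE) (rule that)
    have "tlen (s3 ?r1) \<le> q n"
      using tlen_le_nodes[of "F d"] ptime_by_size[OF F, of d] s3 by (simp add: n_def)
    then have t9: "t9 \<le> (11 * b n + 13) * q n + 2"
    proof -
      have "(11 * b n + 13) * tlen (s3 ?r1) \<le> (11 * b n + 13) * q n" by (rule mult_le_mono2) fact
      moreover have "t9 \<le> (11 * b n + 13) * tlen (s3 ?r1) + 2" using 9(2) by (simp add: add.commute)
      ultimately show ?thesis by linarith
    qed
    let ?s10 = "s9(0 := s9 ?r2)"
    have e: "exec (Assign M (Var 0)) s 2 s0" "exec (Assign ?r1 (Var 0)) s1 2 s2"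
      "exec (Assign ?r2 Empty) s2 2 s3" "exec (Assign 0 (Var ?r2)) s9 2 ?s10"
      by (rule exec_Assign; simp add: s0_def d_def s2_def s3_def)+
    have "exec p s (2 + (t1 + (2 + (2 + (t9 + 2))))) ?s10"
      unfolding p_def
      by (rule exec_Seq[OF e(1) exec_Seq[OF 1(1) exec_Seq[OF e(2) exec_Seq[OF e(3) exec_Seq[OF 9(1) e(4)]]]]]; rule refl)
    moreover have "2 + (t1 + (2 + (2 + (t9 + 2)))) \<le> q n * b n + (q n + ((11 * b n + 13) * q n + 20))"
      using 1(2) t9 s0 by (simp add: n_def)
    moreover have "?s10 0 = collect (G d) (F d)" using 9(4) s3 by (simp add: collect_def)
    moreover have "\<forall>x \<ge> Suc ?r2. ?s10 x = s x" using 9(3) by (auto simp: Q_def)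
    ultimately show "\<exists>t s'. exec p s t s' \<and> t \<le> q (nodes (s 0)) * b (nodes (s 0)) +
        (q (nodes (s 0)) + ((11 * b (nodes (s 0)) + 13) * q (nodes (s 0)) + 20)) \<and>
        s' 0 = collect (G (s 0)) (F (s 0)) \<and> (\<forall>x \<ge> Suc ?r2. s' x = s x)"
      unfolding n_def d_def by (intro exI[of _ "2 + (t1 + (2 + (2 + (t9 + 2))))"] exI[of _ ?s10] conjI)
  qed
qed

lemma tlen_drop_by: "tlen (drop_by x y) = tlen y - tlen x"
proof -
  have tl: "tlen (tl_tree y) = tlen y - 1" for y by (cases y) auto
  have "tlen (sweep (\<lambda>_. tl_tree) x y) = tlen y - tlen x"
    by (induction x arbitrary: y) (auto simp: tl)
  then show ?thesis by (simp add: drop_by_def)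
qed

lemma nodes_drop_by: "nodes (drop_by x y) \<le> nodes y"
proof -
  have "nodes (sweep (\<lambda>_. tl_tree) x y) \<le> nodes y"
  proof (induction x arbitrary: y)
    case (Node a b)
    show ?case using Node.IH(2)[of "tl_tree y"] nodes_tl[of y] by simp
  qed simp
  then show ?thesis by (simp add: drop_by_def)
qed

lemma ptime_drop_by:
  assumes "ptime F" "ptime G"
  shows "ptime (\<lambda>d. drop_by (F d) (G d))"
proof -
  define body where "body = Seq (Assign 2 (Tl (Var 2))) (Assign 1 (Tl (Var 1)))"
  define p where "p = Seq (Assign 1 (Hd (Var 0))) (Seq (Assign 2 (Tl (Var 0)))
    (Seq (While (Var 1) body) (Assign 0 (Var 2))))"
  have "ptime (\<lambda>d. drop_by (hd_tree d) (tl_tree d))"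
  proof (rule ptimeI[of "\<lambda>n. 8 * n + 20"])
    show "poly_bounded (\<lambda>n. 8 * n + 20)" by (intro poly_bounded_add poly_bounded_mult poly_bounded_id poly_bounded_const)
    show "nodes (drop_by (hd_tree d) (tl_tree d)) \<le> 8 * nodes d + 20" for d
      using nodes_drop_by[of "hd_tree d" "tl_tree d"] nodes_tl[of d] by linarith
    fix s :: store
    define s2 where "s2 = s(1 := hd_tree (s 0), 2 := tl_tree (s 0))"
    define Q where "Q s' \<longleftrightarrow> (\<forall>x \<ge> 3. s' x = s x)" for s' :: store
    have "\<exists>t s'. exec (While (Var 1) body) s2 t s' \<and> t \<le> (6 + 2) * tlen (s2 1) + 2 \<and> Q s' \<and>
       s' 2 = sweep (\<lambda>_. tl_tree) (s2 1) (s2 2)"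
    proof (rule exec_sweep[where st = "\<lambda>s. s 2" and Q = Q])
      show "Q s2" by (simp add: Q_def s2_def)
      fix s3 :: store and a b
      assume s3: "s3 1 = Node a b" "Q s3"
      let ?s4 = "s3(2 := tl_tree (s3 2))"
      have 1: "exec (Assign 2 (Tl (Var 2))) s3 3 ?s4" by (rule exec_Assign) auto
      have 2: "exec (Assign 1 (Tl (Var 1))) ?s4 3 (?s4(1 := b))" by (rule exec_Assign) (use s3 in auto)
      show "\<exists>t s'. exec body s3 t s' \<and> t \<le> 6 \<and> s' 1 = b \<and> Q s' \<and> s' 2 = tl_tree (s3 2)"
        using exec.Seq[OF 1 2] s3 unfolding body_def
        by (intro exI[of _ 6] exI[of _ "?s4(1 := b)"]) (auto simp: Q_def)
    qed
    then obtain t s3 where 3: "exec (While (Var 1) body) s2 t s3" "t \<le> (6 + 2) * tlen (s2 1) + 2" "Q s3"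
       "s3 2 = sweep (\<lambda>_. tl_tree) (s2 1) (s2 2)" by (elim exE conjE) (rule that)
    have e: "exec (Assign 1 (Hd (Var 0))) s 3 (s(1 := hd_tree (s 0)))"
      "exec (Assign 2 (Tl (Var 0))) (s(1 := hd_tree (s 0))) 3 s2"
      "exec (Assign 0 (Var 2)) s3 2 (s3(0 := s3 2))"
      by (rule exec_Assign; simp add: s2_def)+
    have "exec p s (3 + (3 + (t + 2))) (s3(0 := s3 2))"
      unfolding p_def by (rule exec_Seq[OF e(1) exec_Seq[OF e(2) exec_Seq[OF 3(1) e(3)]]]; rule refl)
    moreover have "tlen (s2 1) \<le> nodes (s 0)"
      using tlen_le_nodes[of "hd_tree (s 0)"] nodes_hd[of "s 0"] by (simp add: s2_def)
    ultimately show "\<exists>t s'. exec p s t s' \<and> t \<le> 8 * nodes (s 0) + 20 \<and>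
        s' 0 = drop_by (hd_tree (s 0)) (tl_tree (s 0)) \<and> (\<forall>x \<ge> 3. s' x = s x)"
      using 3 by (intro exI[of _ "3 + (3 + (t + 2))"] exI[of _ "s3(0 := s3 2)"]) (auto simp: Q_def s2_def drop_by_def)
  qed
  from ptime_comp[OF this ptime_Node[OF assms]] show ?thesis by simp
qed


section \<open>Decidable predicates and bounded quantifiers\<close>

definition btree :: "bool \<Rightarrow> tree" where
  "btree b = (if b then Node Leaf Leaf else Leaf)"

definition pdec :: "(tree \<Rightarrow> bool) \<Rightarrow> bool" where
  "pdec P \<longleftrightarrow> ptime (\<lambda>d. btree (P d))"

lemma btree_Leaf_iff [simp]: "btree b = Leaf \<longleftrightarrow> \<not> b"
  by (simp add: btree_def)

lemma tlist_btree: "tlist (btree b) = (if b then [Leaf] else [])"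
  by (simp add: btree_def)

lemma ptime_if:
  assumes "pdec P" "ptime F" "ptime G"
  shows "ptime (\<lambda>d. if P d then F d else G d)"
proof -
  have "ptime (\<lambda>d. if btree (P d) = Leaf then G d else F d)"
    using assms unfolding pdec_def by (intro ptime_If)
  moreover have "(\<lambda>d. if btree (P d) = Leaf then G d else F d) = (\<lambda>d. if P d then F d else G d)" by auto
  ultimately show ?thesis by simp
qed

lemma pdec_Leaf:
  assumes "ptime F"
  shows "pdec (\<lambda>d. F d = Leaf)"
proof -
  have "ptime (\<lambda>d. if F d = Leaf then btree True else btree False)"
    by (rule ptime_If[OF assms ptime_const ptime_const])
  moreover have "(\<lambda>d. if F d = Leaf then btree True else btree False) = (\<lambda>d. btree (F d = Leaf))" by auto
  ultimately show ?thesis by (simp add: pdec_def)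
qed

lemma pdec_not: "pdec P \<Longrightarrow> pdec (\<lambda>d. \<not> P d)"
  using pdec_Leaf[of "\<lambda>d. btree (P d)"] by (simp add: pdec_def)

lemma pdec_conj:
  assumes "pdec P" "pdec Q"
  shows "pdec (\<lambda>d. P d \<and> Q d)"
proof -
  have "ptime (\<lambda>d. if btree (P d) = Leaf then Leaf else btree (Q d))"
    using assms unfolding pdec_def by (intro ptime_If ptime_const)
  moreover have "(\<lambda>d. if btree (P d) = Leaf then Leaf else btree (Q d)) = (\<lambda>d. btree (P d \<and> Q d))"
    by (auto simp: btree_def)
  ultimately show ?thesis by (simp add: pdec_def)
qed

lemma pdec_imp: "pdec P \<Longrightarrow> pdec Q \<Longrightarrow> pdec (\<lambda>d. P d \<longrightarrow> Q d)"
  using pdec_not[OF pdec_conj[of P "\<lambda>d. \<not> Q d"]] pdec_not[of Q] by simp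

lemma pdec_le:
  assumes "ptime F" "ptime G"
  shows "pdec (\<lambda>d. tlen (F d) \<le> tlen (G d))"
proof -
  have "drop_by y x = Leaf \<longleftrightarrow> tlen x \<le> tlen y" for x y
    using tlen_drop_by[of y x] by (cases "drop_by y x") auto
  then show ?thesis using pdec_Leaf[OF ptime_drop_by[OF assms(2,1)]] by simp
qed

lemma pdec_eq:
  assumes "ptime F" "ptime G"
  shows "pdec (\<lambda>d. tlen (F d) = tlen (G d))"
  using pdec_conj[OF pdec_le[OF assms] pdec_le[OF assms(2,1)]] by (simp add: order_eq_iff)

lemma pdec_less:
  assumes "ptime F" "ptime G"
  shows "pdec (\<lambda>d. tlen (F d) < tlen (G d))"
  using pdec_not[OF pdec_le[OF assms(2,1)]] by (simp add: not_le)

lemma map_hd_tails: "map hd_tree (tails x) = tlist x"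
  by (induction x) auto

text \<open>As lists, the truth values have one entry or none, so collecting them along a list gives
  the empty list exactly if no entry satisfies \<open>P\<close>.\<close>

lemma pdec_bex:
  assumes "ptime F" "pdec (\<lambda>e. P (hd_tree e) (tl_tree e))"
  shows "pdec (\<lambda>d. \<exists>a \<in> set (tlist (F d)). P d a)"
proof -
  let ?R = "\<lambda>d. collect (\<lambda>\<tau>. btree (P d (hd_tree \<tau>))) (F d)"
  have "ptime (\<lambda>e. btree (P (hd_tree (Node (hd_tree e) (hd_tree (tl_tree e)))) (tl_tree (Node (hd_tree e) (hd_tree (tl_tree e))))))"
    by (rule ptime_comp[OF assms(2)[unfolded pdec_def]]) (intro ptime_Node ptime_hd ptime_tl ptime_id)
  then have "ptime ?R" by (intro ptime_collect assms(1)) simp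
  moreover have "?R d = Leaf \<longleftrightarrow> \<not> (\<exists>a \<in> set (tlist (F d)). P d a)" for d
  proof -
    have "?R d = Leaf \<longleftrightarrow> tlist (?R d) = []" by (cases "?R d") auto
    also have "\<dots> \<longleftrightarrow> \<not> (\<exists>a \<in> set (map hd_tree (tails (F d))). P d a)"
      by (auto simp: tlist_collect tlist_btree)
    finally show ?thesis by (simp only: map_hd_tails)
  qed
  ultimately show ?thesis using pdec_not[OF pdec_Leaf[of ?R]] by simp
qed

lemma pdec_ball:
  assumes "ptime F" "pdec (\<lambda>e. P (hd_tree e) (tl_tree e))"
  shows "pdec (\<lambda>d. \<forall>a \<in> set (tlist (F d)). P d a)"
  using pdec_not[OF pdec_bex[OF assms(1) pdec_not[OF assms(2)]]] by simp

section \<open>Unary numbers and loops with an index\<close>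

definition unary :: "tree \<Rightarrow> tree" where
  "unary x = collect (\<lambda>_. Node Leaf Leaf) x"

lemma tlist_inj: "tlist x = tlist y \<Longrightarrow> x = y"
proof (induction x arbitrary: y)
  case Leaf
  then show ?case by (cases y) auto
next
  case (Node a b)
  then show ?case by (cases y) auto
qed

lemma tlist_enc_list [simp]: "tlist (enc_list e xs) = map e xs"
  by (induction xs) auto

lemma tlist_enc_nat [simp]: "tlist (enc_nat n) = replicate n Leaf"
  by (induction n) auto

lemma length_tails: "length (tails x) = tlen x"
  by (induction x) auto

lemma unary_eq: "unary x = enc_nat (tlen x)"
proof (rule tlist_inj)
  have "concat (map (\<lambda>\<tau>. [Leaf]) xs) = replicate (length xs) Leaf" for xs :: "tree list"
    by (induction xs) auto
  then show "tlist (unary x) = tlist (enc_nat (tlen x))"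
    by (simp add: unary_def tlist_collect length_tails)
qed

lemma ptime_unary: "ptime F \<Longrightarrow> ptime (\<lambda>d. unary (F d))"
  unfolding unary_def by (intro ptime_collect ptime_const)

text \<open>The entries are numbered by the lengths of the remaining tails, that is, from the end of the
  list.\<close>

definition enum_collect :: "(tree \<Rightarrow> tree \<Rightarrow> tree) \<Rightarrow> tree \<Rightarrow> tree" where
  "enum_collect g x = collect (\<lambda>\<tau>. g (unary (tl_tree \<tau>)) (hd_tree \<tau>)) x"

lemma tails_enum: "map (\<lambda>\<tau>. (tlen (tl_tree \<tau>), hd_tree \<tau>)) (tails x) =
    rev (zip [0..<tlen x] (rev (tlist x)))"
proof (induction x)
  case (Node a b)
  have "rev (zip [0..<Suc (tlen b)] (rev (tlist b) @ [a])) = (tlen b, a) # rev (zip [0..<tlen b] (rev (tlist b)))"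
    by (simp add: zip_append)
  then show ?case using Node.IH(2) by simp
qed simp

lemma tlist_enum_collect:
  "tlist (enum_collect g x) =
    concat (map (\<lambda>(i, a). rev (tlist (g (enc_nat i) a))) (zip [0..<tlen x] (rev (tlist x))))"
proof -
  let ?h = "\<lambda>(i, a). tlist (g (enc_nat i) a)"
  have "map (\<lambda>\<tau>. tlist (g (unary (tl_tree \<tau>)) (hd_tree \<tau>))) (tails x) =
      map ?h (map (\<lambda>\<tau>. (tlen (tl_tree \<tau>), hd_tree \<tau>)) (tails x))"
    by (simp add: unary_eq)
  also have "\<dots> = rev (map ?h (zip [0..<tlen x] (rev (tlist x))))"
    unfolding tails_enum by (simp add: rev_map)
  finally show ?thesis
    by (simp add: enum_collect_def tlist_collect rev_concat rev_map case_prod_unfold comp_def)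
qed

lemma ptime_enum_collect:
  assumes "ptime F" "ptime (\<lambda>e. G (hd_tree e) (hd_tree (tl_tree e)) (tl_tree (tl_tree e)))"
  shows "ptime (\<lambda>d. enum_collect (G d) (F d))"
proof -
  let ?E = "\<lambda>e. Node (hd_tree e) (Node (unary (tl_tree (tl_tree e))) (hd_tree (tl_tree e)))"
  have "ptime (\<lambda>e. G (hd_tree (?E e)) (hd_tree (tl_tree (?E e))) (tl_tree (tl_tree (?E e))))"
    by (rule ptime_comp[OF assms(2)]) (intro ptime_Node ptime_hd ptime_tl ptime_unary ptime_id)
  then show ?thesis unfolding enum_collect_def by (intro ptime_collect assms(1)) simp
qed

section \<open>The reduction\<close>

definition rev_tree :: "tree \<Rightarrow> tree" where
  "rev_tree x = collect (\<lambda>\<tau>. Node (hd_tree \<tau>) Leaf) x"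

text \<open>Indices count from the end of a list, so the list is reversed first; index
  \<open>i\<close> then meets the domain size of variable \<open>i\<close>.\<close>

definition variables_tree :: "tree \<Rightarrow> tree" where
  "variables_tree x = enum_collect (\<lambda>i a. Node (Node i a) Leaf) (rev_tree x)"

text \<open>Concatenating the domain sizes, which are unary and hence lists, adds them up. The sum
  is easier to compute than the maximum, is at least every domain size, and is at most
  \<open>k * n\<close>.\<close>

definition values_tree :: "tree \<Rightarrow> tree" where
  "values_tree x = enum_collect (\<lambda>i a. Node i Leaf) (collect hd_tree x)"

text \<open>The exponent is not part of the input: unfolding the recursion leaves \<open>t\<close>
  nested loops, which is polynomial because \<open>t\<close> is fixed.\<close>

fun tuples_tree :: "nat \<Rightarrow> tree \<Rightarrow> tree" where
  "tuples_tree 0 x = Node Leaf Leaf"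
| "tuples_tree (Suc t) x =
     collect (\<lambda>\<tau>. collect (\<lambda>\<rho>. Node (Node (hd_tree \<tau>) (hd_tree \<rho>)) Leaf) (tuples_tree t x)) x"

fun zip_tree :: "nat \<Rightarrow> tree \<Rightarrow> tree \<Rightarrow> tree \<Rightarrow> tree" where
  "zip_tree 0 x y z = z"
| "zip_tree (Suc t) x y z = Node (Node (hd_tree x) (hd_tree y)) (zip_tree t (tl_tree x) (tl_tree y) z)"

text \<open>Here \<open>p\<close> and \<open>q\<close> have the shape \<open>((x, d), a)\<close>,
  and numbers are compared as list lengths. As \<open>p\<close> and \<open>q\<close> may coincide,
  constraints of a variable with itself are included.\<close>

definition check_tree :: "tree \<Rightarrow> tree \<Rightarrow> bool" where
  "check_tree C A \<longleftrightarrow> (\<forall>p \<in> set (tlist A). tlen (tl_tree p) < tlen (tl_tree (hd_tree p)) \<and>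
    (\<forall>q \<in> set (tlist A).
      (tlen (hd_tree (hd_tree p)) = tlen (hd_tree (hd_tree q)) \<longrightarrow> tlen (tl_tree p) = tlen (tl_tree q)) \<and>
      (\<forall>c \<in> set (tlist C).
        tlen (hd_tree (hd_tree c)) = tlen (hd_tree (hd_tree p)) \<and>
        tlen (tl_tree (hd_tree c)) = tlen (hd_tree (hd_tree q)) \<longrightarrow>
        (\<exists>w \<in> set (tlist (tl_tree c)). tlen (hd_tree w) = tlen (tl_tree p) \<and> tlen (tl_tree w) = tlen (tl_tree q)))))"

text \<open>The values of the power are indices \<open>u\<close> and \<open>v\<close> of value
  tuples, as the input format asks for numbers. The two tuples are checked jointly, as a single
  partial assignment.\<close>

definition relation_tree :: "nat \<Rightarrow> tree \<Rightarrow> tree \<Rightarrow> tree \<Rightarrow> tree \<Rightarrow> tree" where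
  "relation_tree t C A I J =
     enum_collect (\<lambda>u U. enum_collect (\<lambda>v V.
       if check_tree C (zip_tree t I U (zip_tree t J V Leaf)) then Node (Node u v) Leaf else Leaf) A) A"

text \<open>Every new variable gets all value tuples as its domain; unsuitable ones are excluded by
  the relations alone, which are imposed on all ordered pairs of tuples.\<close>

definition reduction_tree :: "nat \<Rightarrow> tree \<Rightarrow> tree" where
  "reduction_tree t d =
     Node (collect (\<lambda>_. Node (unary (tuples_tree t (values_tree (hd_tree d)))) Leaf)
         (tuples_tree t (variables_tree (hd_tree d))))
       (enum_collect (\<lambda>i I. enum_collect (\<lambda>j J.
           Node (Node (Node i j) (relation_tree t (tl_tree d) (tuples_tree t (values_tree (hd_tree d))) I J)) Leaf)
         (tuples_tree t (variables_tree (hd_tree d)))) (tuples_tree t (variables_tree (hd_tree d))))"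

lemmas ptime_intros = ptime_id ptime_const ptime_hd ptime_tl ptime_Node ptime_unary ptime_if
  ptime_collect ptime_enum_collect pdec_conj pdec_imp pdec_less pdec_eq pdec_ball pdec_bex

lemma ptime_variables: "ptime F \<Longrightarrow> ptime (\<lambda>d. variables_tree (F d))"
  unfolding variables_tree_def rev_tree_def by (intro ptime_intros)

lemma ptime_values: "ptime F \<Longrightarrow> ptime (\<lambda>d. values_tree (F d))"
  unfolding values_tree_def by (intro ptime_intros)

lemma ptime_tuples:
  assumes "ptime F"
  shows "ptime (\<lambda>d. tuples_tree t (F d))"
proof -
  have "ptime (tuples_tree t)"
  proof (induction t)
    case (Suc t)
    have *: "ptime (\<lambda>d. tuples_tree t (F d))" if "ptime F" for F by (rule ptime_comp[OF Suc that])
    have "ptime (\<lambda>x. tuples_tree (Suc t) x)" unfolding tuples_tree.simps by (intro ptime_intros *)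
    then show ?case .
  qed (simp add: ptime_const)
  from ptime_comp[OF this assms] show ?thesis .
qed

lemma ptime_zip:
  "ptime F \<Longrightarrow> ptime G \<Longrightarrow> ptime H \<Longrightarrow> ptime (\<lambda>d. zip_tree t (F d) (G d) (H d))"
  by (induction t arbitrary: F G) (auto intro!: ptime_Node ptime_hd ptime_tl)

lemma pdec_check: "ptime F \<Longrightarrow> ptime G \<Longrightarrow> pdec (\<lambda>d. check_tree (F d) (G d))"
proof -
  have "pdec (\<lambda>d. check_tree (hd_tree d) (tl_tree d))"
    unfolding check_tree_def by (intro ptime_intros)
  from ptime_comp[OF this[unfolded pdec_def] ptime_Node[of F G]]
  show "ptime F \<Longrightarrow> ptime G \<Longrightarrow> pdec (\<lambda>d. check_tree (F d) (G d))" by (simp add: pdec_def)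
qed

lemma ptime_reduction: "ptime (reduction_tree t)"
proof -
  have *: "ptime (\<lambda>d. relation_tree t (F1 d) (F2 d) (F3 d) (F4 d))"
    if "ptime F1" "ptime F2" "ptime F3" "ptime F4" for F1 F2 F3 F4
  proof -
    have "ptime (\<lambda>d. relation_tree t (hd_tree d) (hd_tree (tl_tree d)) (hd_tree (tl_tree (tl_tree d))) (tl_tree (tl_tree (tl_tree d))))"
      unfolding relation_tree_def by (intro ptime_intros ptime_zip pdec_check)
    from ptime_comp[OF this, of "\<lambda>d. Node (F1 d) (Node (F2 d) (Node (F3 d) (F4 d)))"]
    show ?thesis using that by (simp add: ptime_Node)
  qed
  have "ptime (\<lambda>d. reduction_tree t d)"
    unfolding reduction_tree_def by (intro ptime_intros * ptime_tuples ptime_values ptime_variables)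
  then show ?thesis .
qed

section \<open>The reduction as a function on lists\<close>

lemma enc_list_eqI: "tlist x = map e xs \<Longrightarrow> x = enc_list e xs"
  by (rule tlist_inj) simp

lemma tlist_collect_single: "tlist (collect (\<lambda>\<tau>. Node (h (hd_tree \<tau>)) Leaf) x) = rev (map h (tlist x))"
proof -
  have "concat (map (\<lambda>\<tau>. [h (hd_tree \<tau>)]) ts) = map h (map hd_tree ts)" for ts
    by (induction ts) auto
  then show ?thesis by (simp only: tlist_collect tlist.simps map_hd_tails)
qed

lemma variables_tree_enc:
  "variables_tree (enc_list enc_nat ds) = enc_list (enc_pair enc_nat enc_nat) (zip [0..<length ds] ds)"
proof (rule enc_list_eqI)
  have "tlist (rev_tree (enc_list enc_nat ds)) = rev (map enc_nat ds)"
    using tlist_collect_single[of "\<lambda>x. x"] by (simp add: rev_tree_def)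
  then have "tlist (variables_tree (enc_list enc_nat ds)) =
      concat (map (\<lambda>(i, a). [Node (enc_nat i) a]) (zip [0..<length ds] (map enc_nat ds)))"
    by (simp add: variables_tree_def tlist_enum_collect)
  also have "\<dots> = map (\<lambda>(i, a). Node (enc_nat i) a) (zip [0..<length ds] (map enc_nat ds))"
    by (simp add: case_prod_unfold)
  also have "\<dots> = map (enc_pair enc_nat enc_nat) (zip [0..<length ds] ds)"
    by (simp add: zip_map2 comp_def case_prod_unfold) (auto simp: case_prod_unfold)
  finally show "tlist (variables_tree (enc_list enc_nat ds)) =
    map (enc_pair enc_nat enc_nat) (zip [0..<length ds] ds)" .
qed

lemma values_tree_enc: "values_tree (enc_list enc_nat ds) = enc_list enc_nat [0..<sum_list ds]"
proof (rule enc_list_eqI)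
  let ?x = "collect hd_tree (enc_list enc_nat ds)"
  have "tlist ?x = rev (concat (map tlist (map hd_tree (tails (enc_list enc_nat ds)))))"
    by (simp add: tlist_collect comp_def)
  then have "tlen ?x = sum_list ds"
    unfolding map_hd_tails by (simp add: length_concat comp_def)
  have *: "map (\<lambda>p. enc_nat (fst p)) xs = map enc_nat (map fst xs)" for xs :: "(nat \<times> tree) list"
    by simp
  from \<open>tlen ?x = sum_list ds\<close>
  show "tlist (values_tree (enc_list enc_nat ds)) = map enc_nat [0..<sum_list ds]"
    by (simp add: values_tree_def tlist_enum_collect case_prod_unfold) (simp only: *, simp)
qed

text \<open>The reversals copy the order in which \<open>collect\<close> emits its results, so that
  the program and its description agree as lists and not merely as sets.\<close>

fun tuples :: "nat \<Rightarrow> 'a list \<Rightarrow> 'a list list" where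
  "tuples 0 xs = [[]]"
| "tuples (Suc t) xs = rev (concat (map (\<lambda>a. rev (map ((#) a) (tuples t xs))) xs))"

lemma set_tuples: "set (tuples t xs) = {l. length l = t \<and> set l \<subseteq> set xs}"
proof (induction t)
  case (Suc t)
  have "l \<in> set (tuples (Suc t) xs) \<longleftrightarrow> length l = Suc t \<and> set l \<subseteq> set xs" for l
    by (cases l) (auto simp: Suc)
  then show ?case by blast
qed auto

lemma length_tuples: "length (tuples t xs) = length xs ^ t"
  by (induction t) (auto simp: length_concat comp_def sum_list_triv)

lemma tuples_tree_enc: "tuples_tree t (enc_list e xs) = enc_list (enc_list e) (tuples t xs)"
proof (induction t)
  case (Suc t)
  let ?T = "\<lambda>a. tlist (collect (\<lambda>\<rho>. Node (Node a (hd_tree \<rho>)) Leaf) (enc_list (enc_list e) (tuples t xs)))"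
  have T: "?T a = rev (map (\<lambda>l. Node a (enc_list e l)) (tuples t xs))" for a
    using tlist_collect_single[of "Node a" "enc_list (enc_list e) (tuples t xs)"] by (simp add: comp_def)
  show ?case
  proof (rule enc_list_eqI)
    have "tlist (tuples_tree (Suc t) (enc_list e xs)) = rev (concat (map ?T (map hd_tree (tails (enc_list e xs)))))"
      by (simp add: Suc tlist_collect[of _ "enc_list e xs"] comp_def)
    also have "\<dots> = map (enc_list e) (tuples (Suc t) xs)"
      unfolding map_hd_tails T by (simp add: map_concat rev_map comp_def flip: rev_map)
    finally show "tlist (tuples_tree (Suc t) (enc_list e xs)) = map (enc_list e) (tuples (Suc t) xs)" .
  qed
qed simp

lemma tlist_enum_collect_enc:
  "tlist (enum_collect g (enc_list e xs)) =
    concat (map (\<lambda>i. rev (tlist (g (enc_nat i) (e (rev xs ! i))))) [0..<length xs])"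
proof -
  have "zip [0..<length xs] (rev (map e xs)) = map (\<lambda>i. (i, e (rev xs ! i))) [0..<length xs]"
    by (rule nth_equalityI) (auto simp: rev_map)
  then show ?thesis by (simp add: tlist_enum_collect comp_def)
qed

lemma zip_tree_enc:
  "length xs = t \<Longrightarrow> length ys = t \<Longrightarrow>
    zip_tree t (enc_list e xs) (enc_list e' ys) (enc_list (enc_pair e e') zs) =
      enc_list (enc_pair e e') (zip xs ys @ zs)"
proof (induction t arbitrary: xs ys)
  case (Suc t)
  then show ?case by (cases xs; cases ys) auto
qed simp

text \<open>An entry \<open>((x, d), a)\<close> assigns the value \<open>a\<close> to a variable \<open>x\<close> with domain \<open>{..<d}\<close>.\<close>

definition check :: "((nat \<times> nat) \<times> (nat \<times> nat) list) list \<Rightarrow> ((nat \<times> nat) \<times> nat) list \<Rightarrow> bool" where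
  "check cs A \<longleftrightarrow> (\<forall>x d a. ((x, d), a) \<in> set A \<longrightarrow> a < d \<and>
     (\<forall>y d' b. ((y, d'), b) \<in> set A \<longrightarrow> (x = y \<longrightarrow> a = b) \<and>
       (\<forall>R. ((x, y), R) \<in> set cs \<longrightarrow> (a, b) \<in> set R)))"

lemma check_tree_enc:
  "check_tree (enc_list (enc_pair (enc_pair enc_nat enc_nat) (enc_list (enc_pair enc_nat enc_nat))) cs)
     (enc_list (enc_pair (enc_pair enc_nat enc_nat) enc_nat) A) = check cs A"
proof -
  have ball: "(\<forall>z \<in> h ` S. P z) = (\<forall>x \<in> S. P (h x))" and bex: "(\<exists>z \<in> h ` S. P z) = (\<exists>x \<in> S. P (h x))"
    for h :: "'x \<Rightarrow> 'y" and S P by auto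
  have [simp]: "enc_pair e e' p = Node (e (fst p)) (e' (snd p))" for e e' p by (cases p) simp
  have "(\<exists>w \<in> set R. fst w = a \<and> snd w = b) = ((a, b) \<in> set R)" for R :: "(nat \<times> nat) list" and a b
    by force
  then show ?thesis
    unfolding check_tree_def check_def by (simp add: ball bex) (simp add: Ball_def)
qed

definition relation :: "((nat \<times> nat) \<times> (nat \<times> nat) list) list \<Rightarrow> nat list list \<Rightarrow>
    (nat \<times> nat) list \<Rightarrow> (nat \<times> nat) list \<Rightarrow> (nat \<times> nat) list" where
  "relation cs vs I J =
     concat (map (\<lambda>u. rev (map (Pair u) (filter (\<lambda>v. check cs (zip I (vs ! u) @ zip J (vs ! v))) [0..<length vs])))
       [0..<length vs])"

definition power_constraints :: "((nat \<times> nat) \<times> (nat \<times> nat) list) list \<Rightarrow> nat list list \<Rightarrow>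
    (nat \<times> nat) list list \<Rightarrow> ((nat \<times> nat) \<times> (nat \<times> nat) list) list" where
  "power_constraints cs vs xs =
     concat (map (\<lambda>i. rev (map (\<lambda>j. ((i, j), relation cs vs (xs ! i) (xs ! j))) [0..<length xs])) [0..<length xs])"

text \<open>Reversed because \<open>enum_collect\<close> counts from the end: index \<open>i\<close>
  of the program is position \<open>i\<close> here. The same holds for
  \<open>value_tuples\<close>.\<close>

definition variable_tuples :: "nat \<Rightarrow> nat list \<Rightarrow> (nat \<times> nat) list list" where
  "variable_tuples t ds = rev (tuples t (zip [0..<length ds] ds))"

definition value_tuples :: "nat \<Rightarrow> nat list \<Rightarrow> nat list list" where
  "value_tuples t ds = rev (tuples t [0..<sum_list ds])"

fun reduction :: "nat \<Rightarrow> csp_input \<Rightarrow> csp_input" where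
  "reduction t (ds, cs) =
     (replicate (length (variable_tuples t ds)) (length (value_tuples t ds)),
      power_constraints cs (value_tuples t ds) (variable_tuples t ds))"

lemma concat_map_if: "concat (map (\<lambda>v. if P v then [g v] else []) xs) = map g (filter P xs)"
  by (induction xs) auto

lemma relation_tree_enc:
  assumes "\<And>l. l \<in> set vs \<Longrightarrow> length l = t" "length I = t" "length J = t"
  shows "relation_tree t (enc_list (enc_pair (enc_pair enc_nat enc_nat) (enc_list (enc_pair enc_nat enc_nat))) cs)
     (enc_list (enc_list enc_nat) vs)
     (enc_list (enc_pair enc_nat enc_nat) I) (enc_list (enc_pair enc_nat enc_nat) J) =
    enc_list (enc_pair enc_nat enc_nat) (relation cs (rev vs) I J)"
proof (rule enc_list_eqI)
  have len: "length (rev vs ! i) = t" if "i < length vs" for i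
    using assms(1)[of "rev vs ! i"] that by (metis length_rev nth_mem set_rev)
  define C where "C = enc_list (enc_pair (enc_pair enc_nat enc_nat) (enc_list (enc_pair enc_nat enc_nat))) cs"
  have check: "check_tree C (zip_tree t (enc_list (enc_pair enc_nat enc_nat) I) (enc_list enc_nat (rev vs ! u))
      (zip_tree t (enc_list (enc_pair enc_nat enc_nat) J) (enc_list enc_nat (rev vs ! v)) Leaf)) =
     check cs (zip I (rev vs ! u) @ zip J (rev vs ! v))" if "u < length vs" "v < length vs" for u v
    using zip_tree_enc[OF assms(3) len[OF that(2)], of "enc_pair enc_nat enc_nat" enc_nat "[]"]
      zip_tree_enc[OF assms(2) len[OF that(1)], of "enc_pair enc_nat enc_nat" enc_nat "zip J (rev vs ! v)"]
    by (simp add: C_def check_tree_enc)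
  have inner: "tlist (enum_collect (\<lambda>v V. if check_tree C (zip_tree t (enc_list (enc_pair enc_nat enc_nat) I)
        (enc_list enc_nat (rev vs ! u)) (zip_tree t (enc_list (enc_pair enc_nat enc_nat) J) V Leaf))
        then Node (Node (enc_nat u) v) Leaf else Leaf) (enc_list (enc_list enc_nat) vs)) =
      map (\<lambda>v. Node (enc_nat u) (enc_nat v))
        (filter (\<lambda>v. check cs (zip I (rev vs ! u) @ zip J (rev vs ! v))) [0..<length vs])"
    if "u < length vs" for u
    unfolding tlist_enum_collect_enc concat_map_if[symmetric]
    by (rule arg_cong[where f = concat], rule map_cong) (auto simp: check[OF that])
  have "tlist (relation_tree t C (enc_list (enc_list enc_nat) vs)
      (enc_list (enc_pair enc_nat enc_nat) I) (enc_list (enc_pair enc_nat enc_nat) J)) =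
    concat (map (\<lambda>u. rev (tlist (enum_collect (\<lambda>v V. if check_tree C (zip_tree t (enc_list (enc_pair enc_nat enc_nat) I)
        (enc_list enc_nat (rev vs ! u)) (zip_tree t (enc_list (enc_pair enc_nat enc_nat) J) V Leaf))
        then Node (Node (enc_nat u) v) Leaf else Leaf) (enc_list (enc_list enc_nat) vs)))) [0..<length vs])"
    unfolding relation_tree_def by (rule tlist_enum_collect_enc)
  also have "\<dots> = concat (map (\<lambda>u. rev (map (\<lambda>v. Node (enc_nat u) (enc_nat v))
        (filter (\<lambda>v. check cs (zip I (rev vs ! u) @ zip J (rev vs ! v))) [0..<length vs]))) [0..<length vs])"
    by (intro arg_cong[where f = concat] map_cong refl) (simp add: inner)
  also have "\<dots> = map (enc_pair enc_nat enc_nat) (relation cs (rev vs) I J)"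
    by (simp add: relation_def map_concat rev_map comp_def)
  finally show "tlist (relation_tree t (enc_list (enc_pair (enc_pair enc_nat enc_nat) (enc_list (enc_pair enc_nat enc_nat))) cs)
     (enc_list (enc_list enc_nat) vs)
     (enc_list (enc_pair enc_nat enc_nat) I) (enc_list (enc_pair enc_nat enc_nat) J)) =
     map (enc_pair enc_nat enc_nat) (relation cs (rev vs) I J)"
    unfolding C_def .
qed

text \<open>The bridge from the program to its mathematical description; the correctness proof
  speaks of \<open>reduction\<close> only.\<close>

lemma reduction_tree_enc: "reduction_tree t (enc_input I) = enc_input (reduction t I)"
proof (cases I)
  case (Pair ds cs)
  let ?ip = "enc_pair enc_nat enc_nat"
  let ?ci = "enc_pair ?ip (enc_list ?ip)"
  let ?X = "tuples t (zip [0..<length ds] ds)" and ?V = "tuples t [0..<sum_list ds]"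
  have X: "tuples_tree t (variables_tree (enc_list enc_nat ds)) = enc_list (enc_list ?ip) ?X"
    by (simp add: variables_tree_enc tuples_tree_enc)
  have V: "tuples_tree t (values_tree (enc_list enc_nat ds)) = enc_list (enc_list enc_nat) ?V"
    by (simp add: values_tree_enc tuples_tree_enc)
  have "collect (\<lambda>_. Node (unary (enc_list (enc_list enc_nat) ?V)) Leaf) (enc_list (enc_list ?ip) ?X) =
     enc_list enc_nat (replicate (length ?X) (length ?V))"
  proof (rule enc_list_eqI)
    show "tlist (collect (\<lambda>_. Node (unary (enc_list (enc_list enc_nat) ?V)) Leaf) (enc_list (enc_list ?ip) ?X)) =
      map enc_nat (replicate (length ?X) (length ?V))"
      using tlist_collect_single[of "\<lambda>_. unary (enc_list (enc_list enc_nat) ?V)"]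
      by (simp add: unary_eq map_replicate_const map_replicate)
  qed
  moreover have "enum_collect (\<lambda>i I. enum_collect (\<lambda>j J.
        Node (Node (Node i j) (relation_tree t (enc_list ?ci cs) (enc_list (enc_list enc_nat) ?V) I J)) Leaf)
         (enc_list (enc_list ?ip) ?X)) (enc_list (enc_list ?ip) ?X) =
    enc_list ?ci (power_constraints cs (rev ?V) (rev ?X))"
  proof (rule enc_list_eqI)
    have len: "length (rev ?X ! i) = t" if "i < length ?X" for i
    proof -
      have "rev ?X ! i \<in> set (rev ?X)" using that by (intro nth_mem) simp
      then show ?thesis by (simp add: set_tuples)
    qed
    have rel: "relation_tree t (enc_list ?ci cs) (enc_list (enc_list enc_nat) ?V) (enc_list ?ip (rev ?X ! i)) (enc_list ?ip (rev ?X ! j)) =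
       enc_list ?ip (relation cs (rev ?V) (rev ?X ! i) (rev ?X ! j))" if "i < length ?X" "j < length ?X" for i j
      by (rule relation_tree_enc) (use len that in \<open>auto simp: set_tuples\<close>)
    let ?inner = "\<lambda>i I. enum_collect (\<lambda>j J. Node (Node (Node i j)
         (relation_tree t (enc_list ?ci cs) (enc_list (enc_list enc_nat) ?V) I J)) Leaf) (enc_list (enc_list ?ip) ?X)"
    have inner: "tlist (?inner (enc_nat i) (enc_list ?ip (rev ?X ! i))) =
       map (\<lambda>j. ?ci ((i, j), relation cs (rev ?V) (rev ?X ! i) (rev ?X ! j))) [0..<length ?X]"
      if "i < length ?X" for i
    proof -
      have "tlist (?inner (enc_nat i) (enc_list ?ip (rev ?X ! i))) =
        concat (map (\<lambda>j. [?ci ((i, j), relation cs (rev ?V) (rev ?X ! i) (rev ?X ! j))]) [0..<length ?X])"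
        unfolding tlist_enum_collect_enc
        by (intro arg_cong[where f = concat] map_cong refl) (simp add: rel[OF that])
      then show ?thesis by simp
    qed
    have "tlist (enum_collect ?inner (enc_list (enc_list ?ip) ?X)) =
        concat (map (\<lambda>i. rev (tlist (?inner (enc_nat i) (enc_list ?ip (rev ?X ! i))))) [0..<length ?X])"
      by (rule tlist_enum_collect_enc)
    also have "\<dots> = concat (map (\<lambda>i. rev (map (\<lambda>j. ?ci ((i, j), relation cs (rev ?V) (rev ?X ! i) (rev ?X ! j)))
        [0..<length ?X])) [0..<length ?X])"
      by (intro arg_cong[where f = concat] map_cong refl) (simp add: inner)
    also have "\<dots> = map ?ci (power_constraints cs (rev ?V) (rev ?X))"
      by (simp add: power_constraints_def map_concat rev_map comp_def)
    finally show "tlist (enum_collect ?inner (enc_list (enc_list ?ip) ?X)) =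
       map ?ci (power_constraints cs (rev ?V) (rev ?X))" .
  qed
  ultimately show ?thesis
    by (simp add: Pair reduction_tree_def X V variable_tuples_def value_tuples_def)
qed

section \<open>Correctness of the reduction\<close>

lemma set_relation:
  "set (relation cs vs I J) = {(u, v). u < length vs \<and> v < length vs \<and> check cs (zip I (vs ! u) @ zip J (vs ! v))}"
  by (auto simp: relation_def)

lemma set_power_constraints:
  "set (power_constraints cs vs xs) =
    {((i, j), relation cs vs (xs ! i) (xs ! j)) | i j. i < length xs \<and> j < length xs}"
  by (force simp: power_constraints_def)

text \<open>Each element reveals its block through \<open>key\<close>, so different blocks are
  disjoint.\<close>

lemma distinct_concat_key:
  assumes "distinct is" "\<And>i. i \<in> set is \<Longrightarrow> distinct (f i) \<and> (\<forall>x \<in> set (f i). key x = i)"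
  shows "distinct (concat (map f is))"
  using assms
proof (induction "is")
  case (Cons i js)
  have "set (f i) \<inter> set (concat (map f js)) = {}"
  proof (rule equals0I)
    fix x assume x: "x \<in> set (f i) \<inter> set (concat (map f js))"
    then obtain j where "j \<in> set js" "x \<in> set (f j)" by auto
    then have "key x = j" "key x = i" using Cons.prems(2) x by auto
    with \<open>j \<in> set js\<close> Cons.prems(1) show False by simp
  qed
  with Cons show ?case by simp
qed simp

lemma distinct_relation: "distinct (relation cs vs I J)"
  unfolding relation_def
  by (rule distinct_concat_key[where key = fst]) (auto simp: distinct_map inj_on_def)

lemma distinct_power_constraints: "distinct (map fst (power_constraints cs vs xs))"
proof -
  have "map fst (power_constraints cs vs xs) = concat (map (\<lambda>i. rev (map (Pair i) [0..<length xs])) [0..<length xs])"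
    by (simp add: power_constraints_def map_concat rev_map comp_def)
  moreover have "distinct \<dots>"
    by (rule distinct_concat_key[where key = fst]) (auto simp: distinct_map inj_on_def)
  ultimately show ?thesis by simp
qed

lemma length_variable_tuples: "length (variable_tuples t ds) = length ds ^ t"
  by (simp add: variable_tuples_def length_tuples)

lemma length_value_tuples: "length (value_tuples t ds) = sum_list ds ^ t"
  by (simp add: value_tuples_def length_tuples)

lemma alphabet_size_csp_of:
  "alphabet_size (csp_of (ds, cs)) = Max ((!) ds ` {..<length ds})"
  by (simp add: alphabet_size_def)

lemma valid_inputD:
  assumes "valid_input (ds, cs)"
  shows "length ds \<ge> 1" "\<And>x. x < length ds \<Longrightarrow> ds ! x \<le> alphabet_size (csp_of (ds, cs))" "sum_list ds \<ge> 1"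
    "\<And>w1 w2 R. ((w1, w2), R) \<in> set cs \<Longrightarrow>
      w1 < length ds \<and> w2 < length ds \<and> set R \<subseteq> {..<ds ! w1} \<times> {..<ds ! w2} \<and> distinct R"
    "distinct (map fst cs)"
proof -
  show k: "length ds \<ge> 1" using assms by (simp add: num_vars_def)
  show "ds ! x \<le> alphabet_size (csp_of (ds, cs))" if "x < length ds" for x
    unfolding alphabet_size_csp_of using that by (intro Max_ge) auto
  have "Max ((!) ds ` {..<length ds}) \<in> (!) ds ` {..<length ds}"
    using k by (intro Max_in) (auto simp: lessThan_empty_iff)
  moreover have "alphabet_size (csp_of (ds, cs)) \<ge> 1" using assms by simp
  \<comment> \<open>A nonempty domain exists, and it keeps the alphabet of the power
    nonempty.\<close>
  ultimately obtain x where "x < length ds" "ds ! x \<ge> 1"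
    unfolding alphabet_size_csp_of by (metis imageE lessThan_iff)
  with elem_le_sum_list[of x ds] show "sum_list ds \<ge> 1" by linarith
  show "w1 < length ds \<and> w2 < length ds \<and> set R \<subseteq> {..<ds ! w1} \<times> {..<ds ! w2} \<and> distinct R"
    if "((w1, w2), R) \<in> set cs" for w1 w2 R
    using assms that by (fastforce simp: is_csp_def)
  show "distinct (map fst cs)" using assms by simp
qed

lemma num_vars_reduction: "num_vars (csp_of (reduction t (ds, cs))) = length ds ^ t"
  by (simp add: num_vars_def length_variable_tuples)

lemma alphabet_size_reduction:
  assumes "length ds \<ge> 1"
  shows "alphabet_size (csp_of (reduction t (ds, cs))) = sum_list ds ^ t"
proof -
  let ?K = "length ds ^ t" and ?M = "sum_list ds ^ t"
  have "(!) (replicate ?K ?M) ` {..<?K} = (\<lambda>_. ?M) ` {..<?K}" by (rule image_cong) auto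
  also have "\<dots> = {?M}"
  proof -
    have "0 \<in> {..<?K}" using assms by auto
    then show ?thesis by (rule image_constant)
  qed
  finally have *: "(!) (replicate ?K ?M) ` {..<?K} = {?M}" .
  show ?thesis
    unfolding reduction.simps alphabet_size_csp_of length_replicate length_variable_tuples length_value_tuples
    by (simp only: * Max_singleton)
qed

lemma valid_reduction:
  assumes "valid_input (ds, cs)"
  shows "valid_input (reduction t (ds, cs))"
proof -
  let ?xs = "variable_tuples t ds" and ?vs = "value_tuples t ds"
  let ?ds = "replicate (length ?xs) (length ?vs)"
  have "is_csp (csp_of (reduction t (ds, cs)))"
    unfolding is_csp_def
  proof (intro conjI)
    show "finite (constrs (csp_of (reduction t (ds, cs))))" by simp
  qed (auto simp: set_power_constraints set_relation)
  moreover have "num_vars (csp_of (reduction t (ds, cs))) \<ge> 1" "alphabet_size (csp_of (reduction t (ds, cs))) \<ge> 1"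
    using valid_inputD(1,3)[OF assms] by (auto simp: num_vars_reduction alphabet_size_reduction simp del: reduction.simps)
  moreover have "\<forall>(w, R) \<in> set (power_constraints cs ?vs ?xs). distinct R"
    by (auto simp: set_power_constraints distinct_relation)
  ultimately show ?thesis by (simp add: distinct_power_constraints)
qed

lemma variable_tupleD:
  assumes "i < length (variable_tuples t ds)"
  shows "length (variable_tuples t ds ! i) = t"
    "\<And>x d. (x, d) \<in> set (variable_tuples t ds ! i) \<Longrightarrow> x < length ds \<and> d = ds ! x"
proof -
  have "variable_tuples t ds ! i \<in> set (variable_tuples t ds)" using assms by (rule nth_mem)
  then have *: "length (variable_tuples t ds ! i) = t" "set (variable_tuples t ds ! i) \<subseteq> set (zip [0..<length ds] ds)"
    by (simp_all add: variable_tuples_def set_tuples)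
  then show "length (variable_tuples t ds ! i) = t" by simp
  show "x < length ds \<and> d = ds ! x" if "(x, d) \<in> set (variable_tuples t ds ! i)" for x d
    using *(2) that by (auto simp: set_zip dest!: subsetD)
qed

lemma length_value_tuple:
  assumes "u < length (value_tuples t ds)"
  shows "length (value_tuples t ds ! u) = t"
proof -
  have "value_tuples t ds ! u \<in> set (value_tuples t ds)" using assms by (rule nth_mem)
  then show ?thesis by (simp add: value_tuples_def set_tuples)
qed

lemma checkI:
  assumes "\<And>x d a. ((x, d), a) \<in> set A \<Longrightarrow> a < d"
    and "\<And>x d a d' b. ((x, d), a) \<in> set A \<Longrightarrow> ((x, d'), b) \<in> set A \<Longrightarrow> a = b"
    and "\<And>x d a y d' b R. ((x, d), a) \<in> set A \<Longrightarrow> ((y, d'), b) \<in> set A \<Longrightarrow> ((x, y), R) \<in> set cs \<Longrightarrow> (a, b) \<in> set R"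
  shows "check cs A"
  unfolding check_def using assms by metis

lemma satisfiable_reduction:
  assumes valid: "valid_input (ds, cs)" and sat: "satisfiable (csp_of (ds, cs))"
  shows "satisfiable (csp_of (reduction t (ds, cs)))"
proof -
  let ?xs = "variable_tuples t ds" and ?vs = "value_tuples t ds"
  obtain \<sigma> where \<sigma>: "\<And>x. x < length ds \<Longrightarrow> \<sigma> x < ds ! x"
    "\<And>w1 w2 R. ((w1, w2), R) \<in> set cs \<Longrightarrow> (\<sigma> w1, \<sigma> w2) \<in> set R"
    using sat by (fastforce simp: satisfiable_def is_assignment_def)
  \<comment> \<open>The restriction of \<open>\<sigma>\<close> to a tuple is a value tuple, since
    its values lie below domain sizes and these are at most \<open>sum_list ds\<close>.\<close>
  have "\<exists>u < length ?vs. ?vs ! u = map (\<sigma> \<circ> fst) (?xs ! i)" if i: "i < length ?xs" for i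
  proof -
    have "\<sigma> x < sum_list ds" if "x < length ds" for x
      using \<sigma>(1)[OF that] elem_le_sum_list[OF that] by linarith
    then have "map (\<sigma> \<circ> fst) (?xs ! i) \<in> set ?vs"
      using variable_tupleD[OF i] by (auto simp: value_tuples_def set_tuples)
    then show ?thesis by (simp add: in_set_conv_nth)
  qed
  then obtain \<tau> where \<tau>: "\<And>i. i < length ?xs \<Longrightarrow> \<tau> i < length ?vs \<and> ?vs ! \<tau> i = map (\<sigma> \<circ> fst) (?xs ! i)"
    by metis
  have zip: "((x, d), a) \<in> set (zip I (map (\<sigma> \<circ> fst) I)) \<longleftrightarrow> (x, d) \<in> set I \<and> a = \<sigma> x" for x d a I
    by (induction I) auto
  have "check cs (zip (?xs ! i) (?vs ! \<tau> i) @ zip (?xs ! j) (?vs ! \<tau> j))"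
    if i: "i < length ?xs" and j: "j < length ?xs" for i j
  proof -
    have A: "x < length ds \<and> d = ds ! x \<and> a = \<sigma> x"
      if "((x, d), a) \<in> set (zip (?xs ! i) (?vs ! \<tau> i) @ zip (?xs ! j) (?vs ! \<tau> j))" for x d a
      using that \<tau>[OF i] \<tau>[OF j] variable_tupleD(2)[OF i] variable_tupleD(2)[OF j] by (auto simp: zip)
    show ?thesis
    proof (rule checkI)
      fix x d a assume 1: "((x, d), a) \<in> set (zip (?xs ! i) (?vs ! \<tau> i) @ zip (?xs ! j) (?vs ! \<tau> j))"
      then show "a < d" using A[OF 1] \<sigma>(1) by simp
      fix y d' b assume 2: "((y, d'), b) \<in> set (zip (?xs ! i) (?vs ! \<tau> i) @ zip (?xs ! j) (?vs ! \<tau> j))"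
      show "(a, b) \<in> set R" if "((x, y), R) \<in> set cs" for R
        using A[OF 1] A[OF 2] \<sigma>(2)[OF that] by simp
    next
      fix x d a d' b
      assume 1: "((x, d), a) \<in> set (zip (?xs ! i) (?vs ! \<tau> i) @ zip (?xs ! j) (?vs ! \<tau> j))"
        and 2: "((x, d'), b) \<in> set (zip (?xs ! i) (?vs ! \<tau> i) @ zip (?xs ! j) (?vs ! \<tau> j))"
      show "a = b" using A[OF 1] A[OF 2] by simp
    qed
  qed
  then have "(\<tau> i, \<tau> j) \<in> set (relation cs ?vs (?xs ! i) (?xs ! j))" if "i < length ?xs" "j < length ?xs" for i j
    using that \<tau> by (simp add: set_relation)
  then have "\<forall>((w1, w2), R) \<in> constrs (csp_of (reduction t (ds, cs))). (\<tau> w1, \<tau> w2) \<in> R"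
    by (auto simp: set_power_constraints)
  moreover have "is_assignment (csp_of (reduction t (ds, cs))) \<tau>"
    using \<tau> by (auto simp: is_assignment_def)
  ultimately show ?thesis unfolding satisfiable_def by blast
qed

section \<open>From a list assignment of the power to a solution\<close>

definition assigned :: "(nat \<times> nat) list \<Rightarrow> nat list \<Rightarrow> nat \<Rightarrow> nat" where
  "assigned I U x = (case map_of (zip (map fst I) U) x of None \<Rightarrow> 0 | Some a \<Rightarrow> a)"

text \<open>A tuple may repeat a variable. The lookup finds one occurrence, and \<open>check\<close>
  later forces all occurrences to carry the same value.\<close>

lemma assigned_mem:
  assumes "length I = length U" "x \<in> fst ` set I"
  obtains d where "((x, d), assigned I U x) \<in> set (zip I U)"
proof -
  have "x \<in> dom (map_of (zip (map fst I) U))" using assms by simp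
  then obtain a where a: "map_of (zip (map fst I) U) x = Some a" by auto
  then have "(x, a) \<in> set (zip (map fst I) U)" by (rule map_of_SomeD)
  then obtain d where "((x, d), a) \<in> set (zip I U)" by (auto simp: zip_map1)
  with a that show thesis by (simp add: assigned_def)
qed

text \<open>The sets of the gluing argument may contain numbers that are not variables; the common
  default makes all partial assignments agree there.\<close>

lemma assigned_outside: "x \<notin> fst ` set I \<Longrightarrow> assigned I U x = 0"
proof -
  assume x: "x \<notin> fst ` set I"
  have "map_of (zip (map fst I) U) x = None"
  proof (rule ccontr)
    assume "map_of (zip (map fst I) U) x \<noteq> None"
    then obtain a where "(x, a) \<in> set (zip (map fst I) U)" by (auto dest: map_of_SomeD)
    then have "x \<in> set (map fst I)" by (rule set_zip_leftD)
    with x show False by simp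
  qed
  then show ?thesis by (simp add: assigned_def)
qed

lemma check_appendD: "check cs (A @ B) \<Longrightarrow> check cs B"
  unfolding check_def by auto

lemma checkD:
  assumes "check cs A" "((x, d), a) \<in> set A"
  shows "a < d" "((y, d'), b) \<in> set A \<Longrightarrow> x = y \<Longrightarrow> a = b"
    "((y, d'), b) \<in> set A \<Longrightarrow> ((x, y), R) \<in> set cs \<Longrightarrow> (a, b) \<in> set R"
  using assms unfolding check_def by metis+

lemma ex_variable_tuple:
  assumes "length ds \<ge> 1" "card (S \<inter> {..<length ds}) \<le> t"
  shows "\<exists>i < length (variable_tuples t ds). S \<inter> {..<length ds} \<subseteq> fst ` set (variable_tuples t ds ! i)"
proof -
  let ?S = "S \<inter> {..<length ds}"
  \<comment> \<open>Padding with variable 0, which exists as \<open>length ds \<ge> 1\<close>,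
    brings the tuple to length exactly \<open>t\<close>.\<close>
  define l where "l = map (\<lambda>x. (x, ds ! x)) (sorted_list_of_set ?S @ replicate (t - card ?S) 0)"
  have "length l = t" using assms(2) by (simp add: l_def)
  moreover have "set l \<subseteq> set (zip [0..<length ds] ds)"
  proof -
    have "(x, ds ! x) \<in> set (zip [0..<length ds] ds)" if "x < length ds" for x
      using that by (auto simp: in_set_zip intro!: exI[of _ x])
    moreover have "fst p < length ds \<and> p = (fst p, ds ! fst p)" if "p \<in> set l" for p
      using that assms(1) by (auto simp: l_def)
    ultimately show ?thesis by (metis subsetI)
  qed
  ultimately have "l \<in> set (variable_tuples t ds)" by (simp add: variable_tuples_def set_tuples)
  then obtain i where "i < length (variable_tuples t ds)" "variable_tuples t ds ! i = l"
    by (auto simp: in_set_conv_nth)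
  moreover have "?S \<subseteq> fst ` set l" by (simp add: l_def image_Un image_image)
  ultimately show ?thesis by blast
qed

lemma coversE:
  assumes "covers L \<sigma>" "finite W" "card W \<le> 2"
  obtains T e w where "(e, w) \<in> L T" "W \<subseteq> T" "\<forall>x \<in> W. \<sigma> x = w x"
  using assms unfolding covers_def by blast

text \<open>The list of a large tuple \<open>Q\<close> provides at most \<open>r\<close> partial assignments, which serve as the
  colours; by the constraints between \<open>Q\<close> and the tuples of subsets of \<open>Q\<close>, they hit all of these
  subsets.\<close>

lemma satisfiable_of_list_satisfiable:
  fixes r :: nat
  obtains t where "\<And>ds cs. valid_input (ds, cs) \<Longrightarrow> list_satisfiable r (csp_of (reduction t (ds, cs))) \<Longrightarrow>
    satisfiable (csp_of (ds, cs))"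
proof -
  \<comment> \<open>There are \<open>r\<close> colours, one for each position in the list of
    \<open>Q\<close>. The lists have at most \<open>r * r\<close> entries, because each of at most
    \<open>r\<close> partial assignments is offered in every colour.\<close>
  obtain p b where "\<forall>E (L :: nat set \<Rightarrow> (nat \<times> (nat \<Rightarrow> nat)) set).
      small_lists (r + r * r) E L \<longrightarrow> hittable p b L \<longrightarrow> (\<exists>\<sigma>. covers L \<sigma>)"
    using ex_cover[of "r + r * r"] by (elim exE) (rule that)
  then have cover: "\<exists>\<sigma>. covers L \<sigma>" if "small_lists (r + r * r) E L" "hittable p b L"
    for E and L :: "nat set \<Rightarrow> (nat \<times> (nat \<Rightarrow> nat)) set"
    using that by simp
  \<comment> \<open>The union of \<open>p\<close> sets of size \<open>b\<close> must fit into one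
    tuple.\<close>
  define t where "t = p * b"
  have "satisfiable (csp_of (ds, cs))"
    if valid: "valid_input (ds, cs)" and lsat: "list_satisfiable r (csp_of (reduction t (ds, cs)))" for ds cs
  proof -
    define xs where "xs = variable_tuples t ds"
    define vs where "vs = value_tuples t ds"
    define k where "k = length ds"
    note vd = valid_inputD[OF valid, folded k_def]
    have xs: "length (xs ! i) = t" "\<And>x d. (x, d) \<in> set (xs ! i) \<Longrightarrow> x < k \<and> d = ds ! x" if "i < length xs" for i
      using variable_tupleD[of i t ds] that by (simp_all add: xs_def k_def)
    have vs: "length (vs ! u) = t" if "u < length vs" for u
      using length_value_tuple that by (simp add: vs_def)
    from lsat obtain L where L0: "is_list_assignment r (csp_of (reduction t (ds, cs))) L"
      and LC0: "\<forall>((w1, w2), R) \<in> constrs (csp_of (reduction t (ds, cs))). \<exists>u \<in> L w1. \<exists>v \<in> L w2. (u, v) \<in> R"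
      unfolding list_satisfiable_def by (elim exE conjE) (rule that)
    have L: "L i \<subseteq> {..<length vs} \<and> finite (L i) \<and> card (L i) \<le> r" if "i < length xs" for i
      using L0 that by (simp add: is_list_assignment_def xs_def vs_def)
    have LC: "\<exists>u \<in> L i. \<exists>v \<in> L j. (u, v) \<in> set (relation cs vs (xs ! i) (xs ! j))"
      if "i < length xs" "j < length xs" for i j
    proof -
      have "((i, j), relation cs vs (xs ! i) (xs ! j)) \<in> set (power_constraints cs vs xs)"
        using that by (simp add: set_power_constraints)
      then have "((i, j), set (relation cs vs (xs ! i) (xs ! j))) \<in> constrs (csp_of (reduction t (ds, cs)))"
        by (force simp: xs_def vs_def)
      from bspec[OF LC0 this] show ?thesis by simp
    qed
    have "\<forall>S. \<exists>i. card (S \<inter> {..<k}) \<le> t \<longrightarrow> i < length xs \<and> S \<inter> {..<k} \<subseteq> fst ` set (xs ! i)"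
      using ex_variable_tuple[of ds _ t] vd(1) unfolding xs_def k_def by blast
    then obtain \<iota> where "\<forall>S. card (S \<inter> {..<k}) \<le> t \<longrightarrow> \<iota> S < length xs \<and> S \<inter> {..<k} \<subseteq> fst ` set (xs ! \<iota> S)"
      by (elim choice[THEN exE]) (rule that)
    then have \<iota>: "\<iota> S < length xs" "S \<inter> {..<k} \<subseteq> fst ` set (xs ! \<iota> S)" if "card (S \<inter> {..<k}) \<le> t" for S
      using that by simp_all
    define good where "good S = {u \<in> L (\<iota> S). check cs (zip (xs ! \<iota> S) (vs ! u))}" for S
    \<comment> \<open>All colours are offered because the colour that will be used depends on
      \<open>Q\<close>, which is not yet known. Keeping only checked values is what returns domains
      and constraints at the end.\<close>
    define \<Lambda> where "\<Lambda> S = (if card (S \<inter> {..<k}) \<le> t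
      then {..<r} \<times> (\<lambda>u. assigned (xs ! \<iota> S) (vs ! u)) ` good S else {})" for S
    have "small_lists (r + r * r) {..<r} \<Lambda>"
      unfolding small_lists_def
    proof (intro conjI allI)
      fix T
      have "finite (\<Lambda> T) \<and> card (\<Lambda> T) \<le> r * r"
      proof (cases "card (T \<inter> {..<k}) \<le> t")
        case True
        have fin: "finite (good T)" and "card (good T) \<le> card (L (\<iota> T))"
          using L[OF \<iota>(1)[OF True]] by (auto simp: good_def intro!: card_mono)
        then have "card (good T) \<le> r" using L[OF \<iota>(1)[OF True]] by linarith
        then have "card ((\<lambda>u. assigned (xs ! \<iota> T) (vs ! u)) ` good T) \<le> r"
          using card_image_le[OF fin] le_trans by blast
        then show ?thesis using True fin by (simp add: \<Lambda>_def card_cartesian_product)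
      qed (simp add: \<Lambda>_def)
      then show "finite (\<Lambda> T)" "card {..<r} + card (\<Lambda> T) \<le> r + r * r" by simp_all
      show "fst ` \<Lambda> T \<subseteq> {..<r}" by (auto simp: \<Lambda>_def)
    qed simp
    moreover have "hittable p b \<Lambda>"
      unfolding hittable_def
    proof (intro allI impI)
      fix F :: "nat set set" assume F: "bounded_family p b F"
      then have F': "finite F" "card F \<le> p" "\<And>S. S \<in> F \<Longrightarrow> finite S \<and> card S \<le> b"
        by (auto simp: bounded_family_def)
      define Q where "Q = \<Union>F"
      have "card Q \<le> (\<Sum>S \<in> F. card S)" unfolding Q_def by (rule card_Union_le_sum_card)
      also have "\<dots> \<le> (\<Sum>S \<in> F. b)" using F'(3) by (intro sum_mono) simp
      also have "\<dots> \<le> t" using F'(2) by (simp add: t_def)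
      finally have "card Q \<le> t" .
      have fQ: "finite Q" using F' by (auto simp: Q_def)
      have small: "card (S \<inter> {..<k}) \<le> t" if "S \<subseteq> Q" for S
      proof -
        have "S \<inter> {..<k} \<subseteq> Q" using that by auto
        then have "card (S \<inter> {..<k}) \<le> card Q" by (rule card_mono[OF fQ])
        with \<open>card Q \<le> t\<close> show ?thesis by linarith
      qed
      note q = \<iota>[OF small[OF order_refl]]
      \<comment> \<open>Colour \<open>e\<close> stands for position \<open>e\<close> in an
        enumeration of the values of the tuple for \<open>Q\<close>, so the functions
        \<open>z e\<close> do not depend on \<open>S\<close>.\<close>
      obtain ls where ls: "set ls = L (\<iota> Q)" "distinct ls"
        using finite_distinct_list[of "L (\<iota> Q)"] L[OF q(1)] by auto
      then have "length ls \<le> r" using L[OF q(1)] distinct_card[of ls] by simp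
      define z where "z e = assigned (xs ! \<iota> Q) (vs ! (ls ! e))" for e
      have "hits \<Lambda> z S" if "S \<in> F" for S
      proof -
        have SQ: "S \<subseteq> Q" using that by (auto simp: Q_def)
        note s = \<iota>[OF small[OF SQ]]
        \<comment> \<open>The constraint between the tuples for \<open>Q\<close> and
          \<open>S\<close> makes \<open>u\<close> and \<open>v\<close> jointly consistent; since
          \<open>S\<close> lies in \<open>Q\<close>, they agree on the variables in
          \<open>S\<close>.\<close>
        obtain u v where uv: "u \<in> L (\<iota> Q)" "v \<in> L (\<iota> S)" "(u, v) \<in> set (relation cs vs (xs ! \<iota> Q) (xs ! \<iota> S))"
          using LC[OF q(1) s(1)] by blast
        then have ch: "check cs (zip (xs ! \<iota> Q) (vs ! u) @ zip (xs ! \<iota> S) (vs ! v))" and uvM: "u < length vs" "v < length vs"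
          by (auto simp: set_relation)
        obtain e where e: "e < length ls" "ls ! e = u" using uv(1) ls by (metis in_set_conv_nth)
        show ?thesis
        proof (rule hitsI)
          have "v \<in> good S" using uv(2) check_appendD[OF ch] by (simp add: good_def)
          then show "(e, assigned (xs ! \<iota> S) (vs ! v)) \<in> \<Lambda> S"
            using e(1) \<open>length ls \<le> r\<close> small[OF SQ] by (auto simp: \<Lambda>_def)
          fix x assume x: "x \<in> S"
          show "z e x = assigned (xs ! \<iota> S) (vs ! v) x"
          proof (cases "x < k")
            case True
            then have "x \<in> fst ` set (xs ! \<iota> Q)" "x \<in> fst ` set (xs ! \<iota> S)"
              using q(2) s(2) x SQ by auto
            moreover have "length (xs ! \<iota> Q) = length (vs ! u)" "length (xs ! \<iota> S) = length (vs ! v)"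
              using xs(1)[OF q(1)] xs(1)[OF s(1)] vs uvM by auto
            ultimately obtain d d' where
              "((x, d), assigned (xs ! \<iota> Q) (vs ! u) x) \<in> set (zip (xs ! \<iota> Q) (vs ! u))"
              "((x, d'), assigned (xs ! \<iota> S) (vs ! v) x) \<in> set (zip (xs ! \<iota> S) (vs ! v))"
              by (metis assigned_mem)
            with checkD(2)[OF ch] show ?thesis unfolding z_def e(2) by (metis Un_iff set_append)
          next
            case False
            then have "x \<notin> fst ` set (xs ! \<iota> Q)" "x \<notin> fst ` set (xs ! \<iota> S)"
              using xs(2)[OF q(1)] xs(2)[OF s(1)] by auto
            then show ?thesis by (simp add: z_def assigned_outside)
          qed
        qed
      qed
      then show "\<exists>z. \<forall>S \<in> F. hits \<Lambda> z S" by blast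
    qed
    ultimately obtain \<sigma> where \<sigma>: "covers \<Lambda> \<sigma>" using cover by blast
    \<comment> \<open>The entry that covers \<open>W\<close> comes from \<open>good\<close>, hence
      from a checked partial assignment. Singletons then give the domain conditions, and the
      variables of a constraint give its relation.\<close>
    have loc: "\<exists>A. check cs A \<and> (\<forall>x \<in> W. ((x, ds ! x), \<sigma> x) \<in> set A)"
      if W: "finite W" "card W \<le> 2" "W \<subseteq> {..<k}" for W
    proof -
      obtain T e w where T: "(e, w) \<in> \<Lambda> T" "W \<subseteq> T" "\<forall>x \<in> W. \<sigma> x = w x"
        by (rule coversE[OF \<sigma> W(1,2)])
      have small: "card (T \<inter> {..<k}) \<le> t" using T(1) unfolding \<Lambda>_def by (rule contrapos_pp) simp
      have "w \<in> (\<lambda>u. assigned (xs ! \<iota> T) (vs ! u)) ` good T" using T(1) small by (simp add: \<Lambda>_def)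
      then obtain u where u: "u \<in> good T" "w = assigned (xs ! \<iota> T) (vs ! u)" by (elim imageE) (rule that)
      note i = \<iota>[OF small]
      have uM: "u < length vs" using u(1) L[OF i(1)] unfolding good_def by blast
      have "((x, ds ! x), \<sigma> x) \<in> set (zip (xs ! \<iota> T) (vs ! u))" if x: "x \<in> W" for x
      proof -
        have "x \<in> fst ` set (xs ! \<iota> T)" using i(2) x T(2) W(3) by auto
        moreover have "length (xs ! \<iota> T) = length (vs ! u)" using xs(1)[OF i(1)] vs[OF uM] by simp
        ultimately obtain d where d: "((x, d), w x) \<in> set (zip (xs ! \<iota> T) (vs ! u))"
          using u(2) by (metis assigned_mem)
        then have "d = ds ! x" using xs(2)[OF i(1)] set_zip_leftD by metis
        with d T(3) x show ?thesis by simp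
      qed
      then show ?thesis using u(1) unfolding good_def by blast
    qed
    have dom: "\<sigma> x < ds ! x" if x: "x < k" for x
    proof -
      obtain A where "check cs A" "((x, ds ! x), \<sigma> x) \<in> set A" using loc[of "{x}"] x by auto
      then show ?thesis by (rule checkD(1))
    qed
    have con: "(\<sigma> w1, \<sigma> w2) \<in> set R" if c: "((w1, w2), R) \<in> set cs" for w1 w2 R
    proof -
      have "card {w1, w2} \<le> 2" by (simp add: card_insert_if)
      then obtain A where A: "check cs A" "((w1, ds ! w1), \<sigma> w1) \<in> set A" "((w2, ds ! w2), \<sigma> w2) \<in> set A"
        using loc[of "{w1, w2}"] vd(4)[OF c] by auto
      show ?thesis by (rule checkD(3)[OF A c])
    qed
    show ?thesis
      unfolding satisfiable_def is_assignment_def using dom con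
      by (intro exI[of _ \<sigma>]) (auto simp: k_def)
  qed
  then show thesis by (rule that)
qed

section \<open>Running time and computability\<close>

text \<open>A program may leave data in its registers, whereas the next one expects them to be
  empty.\<close>

fun clear :: "nat \<Rightarrow> com" where
  "clear 0 = Skip"
| "clear (Suc m) = Seq (clear m) (Assign (Suc m) Empty)"

lemma exec_clear: "exec (clear m) s (1 + 2 * m) (\<lambda>x. if 1 \<le> x \<and> x \<le> m then Leaf else s x)"
proof (induction m)
  case 0
  have "(\<lambda>x. if 1 \<le> x \<and> x \<le> 0 then Leaf else s x) = s" by auto
  then show ?case using exec.Skip[of s] by simp
next
  case (Suc m)
  have "exec (Assign (Suc m) Empty) (\<lambda>x. if 1 \<le> x \<and> x \<le> m then Leaf else s x) 2
      (\<lambda>x. if 1 \<le> x \<and> x \<le> Suc m then Leaf else s x)"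
    by (rule exec_Assign) auto
  from exec_Seq[OF Suc this refl] show ?case by simp
qed

text \<open>The final store is exactly an initial store, so an arbitrary program can be run on the
  result.\<close>

lemma ptime_exec:
  assumes "ptime F"
  shows "\<exists>c e. \<forall>d. \<exists>t. t \<le> (nodes d + 2) ^ e \<and> exec c (init_store d) t (init_store (F d))"
proof -
  obtain c m q where F: "ptime_by F c m q" using assms by (auto simp: ptime_def)
  have "poly_bounded (\<lambda>n. q n + (1 + 2 * m))"
    by (intro poly_bounded_add ptime_by_poly[OF F] poly_bounded_const)
  then obtain e where e: "\<And>n. q n + (1 + 2 * m) \<le> (n + 2) ^ e" by (auto simp: poly_bounded_def)
  have "\<exists>t. t \<le> (nodes d + 2) ^ e \<and> exec (Seq c (clear m)) (init_store d) t (init_store (F d))" for d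
  proof -
    obtain t s where s: "exec c (init_store d) t s" "t \<le> q (nodes (init_store d 0))"
        "s 0 = F (init_store d 0)" "\<And>x. x \<ge> m \<Longrightarrow> s x = init_store d x"
      using ptime_byE[OF F] by blast
    have "(\<lambda>x. if 1 \<le> x \<and> x \<le> m then Leaf else s x) = init_store (F d)"
      using s(3,4) by (auto simp: init_store_def)
    with exec_clear[of m s] have "exec (clear m) s (1 + 2 * m) (init_store (F d))" by simp
    from exec_Seq[OF s(1) this refl] show ?thesis
      using s(2) e[of "nodes d"] by (intro exI[of _ "t + (1 + 2 * m)"]) (auto simp: init_store_def)
  qed
  then show ?thesis by (intro exI[of _ "Seq c (clear m)"] exI[of _ e]) simp
qed

section \<open>Framing of programs and closure of computability\<close>

fun exp_bound :: "exp \<Rightarrow> nat" where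
  "exp_bound (Var x) = Suc x"
| "exp_bound Empty = 0"
| "exp_bound (Join e1 e2) = max (exp_bound e1) (exp_bound e2)"
| "exp_bound (Hd e) = exp_bound e"
| "exp_bound (Tl e) = exp_bound e"

fun com_bound :: "com \<Rightarrow> nat" where
  "com_bound Skip = 0"
| "com_bound (Assign x e) = max (Suc x) (exp_bound e)"
| "com_bound (Seq c1 c2) = max (com_bound c1) (com_bound c2)"
| "com_bound (If e c1 c2) = max (exp_bound e) (max (com_bound c1) (com_bound c2))"
| "com_bound (While e c) = max (exp_bound e) (com_bound c)"

definition splice_store :: "nat \<Rightarrow> store \<Rightarrow> store \<Rightarrow> store" where
  "splice_store m s u = (\<lambda>x. if x < m then s x else u x)"

lemma val_splice: "exp_bound e \<le> m \<Longrightarrow> val e (splice_store m s u) = val e s"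
  by (induction e) (auto simp: splice_store_def)

text \<open>Registers from \<open>com_bound c\<close> on are neither read nor written, so data may
  be kept there. Arbitrary programs, such as those given by \<open>computable\<close>, lack the
  guarantee built into \<open>ptime_by\<close> and need this instead.\<close>

lemma exec_splice:
  "exec c s t s' \<Longrightarrow> com_bound c \<le> m \<Longrightarrow> exec c (splice_store m s u) t (splice_store m s' u)"
proof (induction rule: exec.induct)
  case (Skip s)
  show ?case by (rule exec.Skip)
next
  case (Assign x e s)
  have "splice_store m (s(x := val e s)) u = (splice_store m s u)(x := val e (splice_store m s u))"
    using Assign val_splice[of e m s u] by (auto simp: splice_store_def)
  then show ?case using exec.Assign[of x e "splice_store m s u"] by (simp only:)
next
  case (Seq c1 s t1 s1 c2 t2 s2)
  then show ?case by (intro exec.Seq[of _ _ _ "splice_store m s1 u"]) auto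
next
  case (IfTrue e s c1 t s' c2)
  then show ?case by (intro exec.IfTrue) (auto simp: val_splice)
next
  case (IfFalse e s c2 t s' c1)
  then show ?case by (intro exec.IfFalse) (auto simp: val_splice)
next
  case (WhileFalse e s c)
  then show ?case by (intro exec.WhileFalse) (auto simp: val_splice)
next
  case (WhileTrue e s c t1 s1 t2 s2)
  then show ?case by (intro exec.WhileTrue[of _ _ _ _ "splice_store m s1 u"]) (auto simp: val_splice)
qed

text \<open>The argument \<open>k\<close> is needed again after \<open>f\<close> has been evaluated;
  it waits in register \<open>m\<close>, beyond the registers of the programs run in
  between.\<close>

lemma computable_combine:
  assumes "computable f"
    and P: "ptime P" "\<And>k. P (enc_nat k) = enc_nat (h k)"
    and G: "ptime G" "\<And>a k. G (Node (enc_nat a) (enc_nat k)) = enc_nat (g a k)"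
  shows "computable (\<lambda>k. g (f (h k)) k)"
proof -
  obtain pf where pf: "\<And>n. outputs pf (enc_nat n) (enc_nat (f n))"
    using assms(1) by (auto simp: computable_def)
  obtain cp e where cp: "\<forall>d. \<exists>t. t \<le> (nodes d + 2) ^ e \<and> exec cp (init_store d) t (init_store (P d))"
    using ptime_exec[OF P(1)] by (elim exE) (rule that)
  obtain cg e' where cg: "\<forall>d. \<exists>t. t \<le> (nodes d + 2) ^ e' \<and> exec cg (init_store d) t (init_store (G d))"
    using ptime_exec[OF G(1)] by (elim exE) (rule that)
  define m where "m = Suc (max (com_bound cp) (com_bound pf))"
  have m: "0 < m" "com_bound cp \<le> m" "com_bound pf \<le> m" by (simp_all add: m_def)
  define p where "p = Seq (Assign m (Var 0)) (Seq cp (Seq pf (Seq (Assign 0 (Join (Var 0) (Var m))) (Seq (clear m) cg))))"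
  have "outputs p (enc_nat k) (enc_nat (g (f (h k)) k))" for k
  proof -
    define u where "u = (\<lambda>_. Leaf)(m := enc_nat k)"
    have 1: "exec (Assign m (Var 0)) (init_store (enc_nat k)) 2 (splice_store m (init_store (enc_nat k)) u)"
      by (rule exec_Assign) (use m(1) in \<open>auto simp: splice_store_def init_store_def u_def\<close>)
    obtain t2 where "exec cp (init_store (enc_nat k)) t2 (init_store (enc_nat (h k)))"
      using cp[THEN spec, of "enc_nat k", unfolded P(2)] by (elim exE conjE) (rule that)
    then have 2: "exec cp (splice_store m (init_store (enc_nat k)) u) t2 (splice_store m (init_store (enc_nat (h k))) u)"
      by (rule exec_splice) (rule m)
    obtain t3 s3 where s3: "exec pf (init_store (enc_nat (h k))) t3 s3" "s3 0 = enc_nat (f (h k))"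
      using pf[of "h k"] unfolding outputs_def by (elim exE conjE) (rule that)
    from s3(1) have 3: "exec pf (splice_store m (init_store (enc_nat (h k))) u) t3 (splice_store m s3 u)"
      by (rule exec_splice) (rule m)
    define s4 where "s4 = (splice_store m s3 u)(0 := Node (enc_nat (f (h k))) (enc_nat k))"
    have 4: "exec (Assign 0 (Join (Var 0) (Var m))) (splice_store m s3 u) 4 s4"
      by (rule exec_Assign) (use m(1) in \<open>simp_all add: splice_store_def u_def s4_def s3(2)\<close>)
    have "(\<lambda>x. if 1 \<le> x \<and> x \<le> m then Leaf else s4 x) = init_store (Node (enc_nat (f (h k))) (enc_nat k))"
      by (auto simp: s4_def init_store_def splice_store_def u_def)
    with exec_clear[of m s4] have 5: "exec (clear m) s4 (1 + 2 * m) (init_store (Node (enc_nat (f (h k))) (enc_nat k)))"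
      by simp
    obtain t6 where 6: "exec cg (init_store (Node (enc_nat (f (h k))) (enc_nat k))) t6 (init_store (enc_nat (g (f (h k)) k)))"
      using cg[THEN spec, of "Node (enc_nat (f (h k))) (enc_nat k)", unfolded G(2)] by (elim exE conjE) (rule that)
    have "exec p (init_store (enc_nat k)) (2 + (t2 + (t3 + (4 + ((1 + 2 * m) + t6))))) (init_store (enc_nat (g (f (h k)) k)))"
      unfolding p_def
      by (rule exec_Seq[OF 1 exec_Seq[OF 2 exec_Seq[OF 3 exec_Seq[OF 4 exec_Seq[OF 5 6]]]]]; rule refl)
    then show ?thesis
      unfolding outputs_def by (intro exI conjI) (assumption, simp add: init_store_def)
  qed
  then show ?thesis by (auto simp: computable_def)
qed

lemma tlen_tuples_tree: "tlen (tuples_tree t x) = tlen x ^ t"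
proof -
  have "enc_list (\<lambda>x. x) (tlist x) = x" by (rule enc_list_eqI[symmetric]) simp
  with tuples_tree_enc[of t "\<lambda>x. x" "tlist x"]
  have "tuples_tree t x = enc_list (enc_list (\<lambda>x. x)) (tuples t (tlist x))" by simp
  then show ?thesis by (simp add: length_tuples)
qed

text \<open>This is the shape of the parameter dependence of the final algorithm. Adding
  \<open>A\<close> prepends entries, and multiplication is a loop that emits a list of length
  \<open>k ^ a\<close> on every pass.\<close>

lemma computable_scale:
  assumes "computable f"
  shows "computable (\<lambda>k. (A + f (k ^ t)) * k ^ a)"
proof -
  define G where "G d = unary (collect (\<lambda>_. tuples_tree a (tl_tree d)) ((Node Leaf ^^ A) (hd_tree d)))" for d
  have "ptime (\<lambda>d. (Node Leaf ^^ A) (hd_tree d))"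
    by (induction A) (auto intro: ptime_hd ptime_id ptime_Node ptime_const)
  then have "ptime G"
    unfolding G_def by (intro ptime_unary ptime_collect ptime_tuples ptime_tl ptime_hd ptime_id)
  moreover have "G (Node (enc_nat b) (enc_nat k)) = enc_nat ((A + b) * k ^ a)" for b k
  proof -
    have add: "tlen ((Node Leaf ^^ A) x) = A + tlen x" for x by (induction A) auto
    have "length (concat (map (\<lambda>_. ys) xs)) = length xs * length ys" for ys :: "tree list" and xs :: "tree list"
      by (induction xs) auto
    then show ?thesis
      by (simp add: G_def unary_eq tlist_collect length_tails add tlen_tuples_tree)
  qed
  moreover have "ptime (\<lambda>d. unary (tuples_tree t d))" by (intro ptime_unary ptime_tuples ptime_id)
  moreover have "unary (tuples_tree t (enc_nat k)) = enc_nat (k ^ t)" for k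
    by (simp add: unary_eq tlen_tuples_tree)
  ultimately show ?thesis
    using computable_combine[OF assms, of "\<lambda>d. unary (tuples_tree t d)" "\<lambda>k. k ^ t" G "\<lambda>b k. (A + b) * k ^ a"]
    by simp
qed

section \<open>Size of the encoded input\<close>

lemma nodes_enc_nat [simp]: "nodes (enc_nat n) = n"
  by (induction n) auto

lemma nodes_enc_list_le:
  "(\<And>x. x \<in> set xs \<Longrightarrow> nodes (e x) \<le> B) \<Longrightarrow> nodes (enc_list e xs) \<le> length xs * (B + 1)"
proof (induction xs)
  case (Cons x xs)
  have "nodes (e x) \<le> B" "nodes (enc_list e xs) \<le> length xs * (B + 1)" using Cons by auto
  then show ?case by simp
qed simp

text \<open>Since nothing is listed twice, there are at most \<open>m * m\<close> constraints with
  at most \<open>m * m\<close> pairs each. The resulting polynomial has degree 5, and its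
  coefficients add up to 12.\<close>

lemma nodes_enc_input:
  assumes valid: "valid_input (ds, cs)"
  defines "m \<equiv> length ds * alphabet_size (csp_of (ds, cs))"
  shows "nodes (enc_input (ds, cs)) \<le> 12 * m ^ 5" "sum_list ds \<le> m" "1 \<le> m"
proof -
  let ?k = "length ds" and ?n = "alphabet_size (csp_of (ds, cs))"
  let ?ip = "enc_pair enc_nat enc_nat"
  note vd = valid_inputD[OF valid]
  have n: "?n \<ge> 1" using valid by simp
  show m: "1 \<le> m" using vd(1) n by (simp add: m_def)
  have km: "?k \<le> m" and nm: "?n \<le> m" using vd(1) n by (simp_all add: m_def)
  have d: "x \<le> ?n" if "x \<in> set ds" for x using that vd(2) by (auto simp: in_set_conv_nth)
  have "sum_list ds = (\<Sum>i<length ds. ds ! i)" by (simp add: sum_list_sum_nth atLeast0LessThan)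
  also have "\<dots> \<le> (\<Sum>i<length ds. ?n)" using vd(2) by (intro sum_mono) simp
  finally show "sum_list ds \<le> m" by (simp add: m_def)
  have D: "nodes (enc_list enc_nat ds) \<le> m * (m + 1)"
  proof -
    have "nodes (enc_list enc_nat ds) \<le> ?k * (m + 1)"
      using d nm by (intro nodes_enc_list_le) (auto intro: le_trans)
    also have "\<dots> \<le> m * (m + 1)" using km by (rule mult_le_mono1)
    finally show ?thesis .
  qed
  have C: "nodes (enc_pair ?ip (enc_list ?ip) c) \<le> 2 + 2 * m + m * m * (2 + 2 * m)" if c: "c \<in> set cs" for c
  proof -
    obtain w1 w2 R where c': "c = ((w1, w2), R)" by (metis prod.collapse)
    note w = vd(4)[OF c[unfolded c']]
    have R: "set R \<subseteq> {..<m} \<times> {..<m}"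
    proof
      fix p assume "p \<in> set R"
      then have "fst p < ds ! w1" "snd p < ds ! w2" using w by auto
      moreover have "ds ! w1 \<le> m" "ds ! w2 \<le> m" using vd(2) w nm le_trans by blast+
      ultimately show "p \<in> {..<m} \<times> {..<m}" by (cases p) auto
    qed
    have "length R = card (set R)" using w distinct_card by metis
    also have "\<dots> \<le> card ({..<m} \<times> {..<m})" by (rule card_mono) (use R in auto)
    finally have lR: "length R \<le> m * m" by (simp add: card_cartesian_product)
    have "nodes (enc_list ?ip R) \<le> length R * (1 + 2 * m + 1)"
    proof (rule nodes_enc_list_le)
      fix p assume "p \<in> set R"
      with R show "nodes (?ip p) \<le> 1 + 2 * m" by (cases p) auto
    qed
    also have "\<dots> \<le> m * m * (1 + 2 * m + 1)" using lR by (rule mult_le_mono1)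
    finally have "nodes (enc_list ?ip R) \<le> m * m * (2 + 2 * m)" by simp
    moreover have "w1 \<le> m" "w2 \<le> m" using w km by auto
    ultimately show ?thesis by (simp add: c')
  qed
  have "length cs = card (set (map fst cs))" using vd(5) distinct_card by (metis length_map)
  also have "\<dots> \<le> card ({..<m} \<times> {..<m})"
  proof (rule card_mono)
    show "set (map fst cs) \<subseteq> {..<m} \<times> {..<m}"
    proof
      fix w assume "w \<in> set (map fst cs)"
      then obtain w1 w2 R where "w = (w1, w2)" "((w1, w2), R) \<in> set cs" by auto
      with vd(4) km show "w \<in> {..<m} \<times> {..<m}" by fastforce
    qed
  qed simp
  finally have lcs: "length cs \<le> m * m" by (simp add: card_cartesian_product)
  have "nodes (enc_list (enc_pair ?ip (enc_list ?ip)) cs) \<le> length cs * (2 + 2 * m + m * m * (2 + 2 * m) + 1)"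
    by (rule nodes_enc_list_le) (rule C)
  also have "\<dots> \<le> m * m * (2 + 2 * m + m * m * (2 + 2 * m) + 1)" using lcs by (rule mult_le_mono1)
  finally have "nodes (enc_input (ds, cs)) \<le> 1 + m * (m + 1) + m * m * (3 + 2 * m + m * m * (2 + 2 * m))"
    using D by (simp add: algebra_simps)
  also have "\<dots> = 1 + m + 4 * m ^ 2 + 2 * m ^ 3 + 2 * m ^ 4 + 2 * m ^ 5"
    by (simp add: algebra_simps power2_eq_square power3_eq_cube eval_nat_numeral)
  also have "\<dots> \<le> 12 * m ^ 5"
  proof -
    have "m ^ i \<le> m ^ 5" if "i \<le> 5" for i using m that by (intro power_increasing) auto
    from this[of 0] this[of 1] this[of 2] this[of 3] this[of 4] show ?thesis by simp
  qed
  finally show "nodes (enc_input (ds, cs)) \<le> 12 * m ^ 5" .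
qed

theorem theorem1p2:
  fixes r :: nat and C :: real and f :: "nat \<Rightarrow> nat"
  assumes "W1_neq_FPT"
    and "r \<ge> 1" and "C \<ge> 1"
    and "computable f"
  shows "\<not> (\<exists>p. distinguishes_list_csp r p \<and> runs_in_time p (\<lambda>k n. real (f k) * real n powr C))"
proof
  assume "\<exists>p. distinguishes_list_csp r p \<and> runs_in_time p (\<lambda>k n. real (f k) * real n powr C)"
  then obtain p where dist: "distinguishes_list_csp r p"
    and time: "runs_in_time p (\<lambda>k n. real (f k) * real n powr C)" by blast
  obtain t where t: "\<And>ds cs. valid_input (ds, cs) \<Longrightarrow> list_satisfiable r (csp_of (reduction t (ds, cs))) \<Longrightarrow>
      satisfiable (csp_of (ds, cs))"
    using satisfiable_of_list_satisfiable[of r] by blast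
  obtain c e where c': "\<forall>d. \<exists>\<tau>. \<tau> \<le> (nodes d + 2) ^ e \<and> exec c (init_store d) \<tau> (init_store (reduction_tree t d))"
    using ptime_exec[OF ptime_reduction[of t]] by (elim exE) (rule that)
  have c: "\<exists>\<tau>. \<tau> \<le> (nodes (enc_input I) + 2) ^ e \<and>
      exec c (init_store (enc_input I)) \<tau> (init_store (enc_input (reduction t I)))" for I
    using c'[THEN spec, of "enc_input I"] unfolding reduction_tree_enc .
  \<comment> \<open>In the exponent \<open>a\<close>, the part \<open>5 * e\<close> pays for the
    reduction and \<open>t * c0\<close> for the given algorithm on the power. The factor
    \<open>14 ^ e\<close> comes from \<open>nodes d + 2\<close> with at most
    \<open>12 * m ^ 5\<close> nodes.\<close>
  define c0 where "c0 = nat \<lceil>C\<rceil>"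
  define a where "a = 5 * e + t * c0"
  define f' where "f' k = (14 ^ e + f (k ^ t)) * k ^ a" for k
  have "computable f'" unfolding f'_def by (rule computable_scale) fact
  moreover have "decides_csp (Seq c p)"
  proof -
    have out: "outputs (Seq c p) (enc_input I) d" if o: "outputs p (enc_input (reduction t I)) d" for I d
    proof -
      obtain t1 where 1: "exec c (init_store (enc_input I)) t1 (init_store (enc_input (reduction t I)))"
        using c[of I] by (elim exE conjE) (rule that)
      obtain t2 s2 where 2: "exec p (init_store (enc_input (reduction t I))) t2 s2" "s2 0 = d"
        using o unfolding outputs_def by (elim exE conjE) (rule that)
      show ?thesis using exec.Seq[OF 1 2(1)] 2(2) unfolding outputs_def by (intro exI conjI)
    qed
    have "(satisfiable (csp_of I) \<longrightarrow> accepts (Seq c p) (enc_input I)) \<and>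
        (\<not> satisfiable (csp_of I) \<longrightarrow> rejects (Seq c p) (enc_input I))" if "valid_input I" for I
    proof (cases I)
      case (Pair ds cs)
      note valid = that[unfolded Pair]
      note dist' = dist[unfolded distinguishes_list_csp_def, rule_format, OF valid_reduction[OF valid]]
      have "accepts (Seq c p) (enc_input I)" if "satisfiable (csp_of I)"
        using dist' satisfiable_reduction[OF valid] that out unfolding Pair accepts_def by blast
      moreover have "rejects (Seq c p) (enc_input I)" if "\<not> satisfiable (csp_of I)"
        using dist' t[OF valid] that out unfolding Pair rejects_def by blast
      ultimately show ?thesis by blast
    qed
    then show ?thesis by (simp add: decides_csp_def)
  qed
  moreover have "runs_in_time (Seq c p) (\<lambda>k n. real (f' k) * real n ^ a)"
    unfolding runs_in_time_def
  proof (intro allI impI)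
    fix I assume I: "valid_input I"
    obtain ds cs where dc: "I = (ds, cs)" by (cases I)
    note valid = I[unfolded dc]
    define k where "k = length ds"
    define n where "n = alphabet_size (csp_of (ds, cs))"
    note size = nodes_enc_input[OF valid, folded k_def n_def]
    obtain t1 where t1: "t1 \<le> (nodes (enc_input I) + 2) ^ e"
      "exec c (init_store (enc_input I)) t1 (init_store (enc_input (reduction t I)))"
      using c by blast
    have K: "num_vars (csp_of (reduction t I)) = k ^ t" "num_vars (csp_of I) = k"
      unfolding dc k_def by (rule num_vars_reduction) (simp add: num_vars_def)
    have N: "alphabet_size (csp_of (reduction t I)) = sum_list ds ^ t" "alphabet_size (csp_of I) = n"
      unfolding dc n_def using alphabet_size_reduction valid_inputD(1)[OF valid] by auto
    have "valid_input (reduction t I)" using valid_reduction[OF valid] by (simp only: dc)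
    then obtain t2 s2 where t2: "exec p (init_store (enc_input (reduction t I))) t2 s2"
      "real t2 \<le> real (f (k ^ t)) * real (sum_list ds ^ t) powr C"
      using time unfolding runs_in_time_def halts_within_def K(1)[symmetric] N(1)[symmetric] by blast
    have "t1 \<le> (14 * (k * n) ^ 5) ^ e"
    proof -
      have "1 \<le> (k * n) ^ 5" using size(3) by (rule one_le_power)
      then have "nodes (enc_input I) + 2 \<le> 14 * (k * n) ^ 5" using size(1) unfolding dc by linarith
      then have "(nodes (enc_input I) + 2) ^ e \<le> (14 * (k * n) ^ 5) ^ e" by (rule power_mono) simp
      with t1(1) show ?thesis by (rule le_trans)
    qed
    also have "\<dots> = 14 ^ e * (k * n) ^ (5 * e)" by (simp only: power_mult_distrib power_mult)
    also have "\<dots> \<le> 14 ^ e * (k * n) ^ a"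
      using size(3) by (intro mult_le_mono2 power_increasing) (auto simp: a_def)
    finally have b1: "t1 \<le> 14 ^ e * (k * n) ^ a" .
    \<comment> \<open>Rounding \<open>C\<close> up to \<open>c0\<close> increases the power because
      the new alphabet size is at least 1; the base is then bounded through
      \<open>sum_list ds \<le> k * n\<close>.\<close>
    have "real (sum_list ds ^ t) powr C \<le> real ((k * n) ^ a)"
    proof -
      have pos: "1 \<le> sum_list ds ^ t" using valid_inputD(3)[OF valid] by (rule one_le_power)
      have "real (sum_list ds ^ t) powr C \<le> real (sum_list ds ^ t) powr real c0"
      proof (rule powr_mono)
        show "C \<le> real c0" unfolding c0_def by linarith
        show "1 \<le> real (sum_list ds ^ t)" using pos by (metis of_nat_1 of_nat_le_iff)
      qed
      also have "\<dots> = real (sum_list ds ^ t) ^ c0" using pos by (intro powr_realpow) (metis of_nat_0_less_iff less_le_trans zero_less_one)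
      also have "\<dots> = real (sum_list ds ^ (t * c0))" by (simp add: power_mult)
      also have "\<dots> \<le> real ((k * n) ^ a)"
      proof -
        have "sum_list ds ^ (t * c0) \<le> (k * n) ^ (t * c0)" using size(2) by (rule power_mono) simp
        also have "\<dots> \<le> (k * n) ^ a" using size(3) by (intro power_increasing) (auto simp: a_def)
        finally show ?thesis by (simp only: of_nat_le_iff)
      qed
      finally show ?thesis .
    qed
    then have "real t2 \<le> real (f (k ^ t)) * real ((k * n) ^ a)"
      using t2(2) by (meson mult_left_mono of_nat_0_le_iff order_trans)
    moreover have "real t1 \<le> real (14 ^ e * (k * n) ^ a)" using b1 by (simp only: of_nat_le_iff)
    ultimately have "real (t1 + t2) \<le> real (14 ^ e * (k * n) ^ a) + real (f (k ^ t)) * real ((k * n) ^ a)" by simp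
    \<comment> \<open>The power of \<open>k * n\<close> splits, and its factor \<open>k ^ a\<close>
      is absorbed by \<open>f'\<close>.\<close>
    also have "\<dots> = real (f' k) * real n ^ a"
      by (simp add: f'_def power_mult_distrib algebra_simps)
    finally show "halts_within (Seq c p) (enc_input I) (real (f' (num_vars (csp_of I))) * real (alphabet_size (csp_of I)) ^ a)"
      unfolding halts_within_def K(2) N(2) using exec.Seq[OF t1(2) t2(1)] by blast
  qed
  ultimately show False using assms(1) unfolding W1_neq_FPT_def by blast
qed

end
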